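(* Let $\mathfrak{g}$ be a semisimple Lie algebra with Killing form $\langle\,,\rangle$, and let $\mathfrak{g}=\mathfrak{g}_0\oplus\mathfrak{g}_1$ be a symmetric decomposition of $\mathfrak{g}$, i.e. $\mathfrak{g}_0$ is a subalgebra and $\mathfrak{g}_1$ a vector subspace such that $[\mathfrak{g}_0,\mathfrak{g}_0]\subset\mathfrak{g}_0$, $[\mathfrak{g}_0,\mathfrak{g}_1]\subset\mathfrak{g}_1$, $[\mathfrak{g}_1,\mathfrak{g}_1]\subset\mathfrak{g}_0$. Assume that $\mathfrak{g}/\mathfrak{g}_0$ has rank $k$ and let $\mathfrak{a}$ be a maximal ($k$-dimensional) abelian subspace of $\mathfrak{g}_1$. Set $$\mathfrak{m}=\mathfrak{a}^\perp\cap\mathfrak{g}_1=\{X\in\mathfrak{g}_1:\langle X,A\rangle=0\ \text{for all}\ A\in\mathfrak{a}\},\qquad (\mathfrak{g}_0)_{\mathfrak{a}}=\{X\in\mathfrak{g}_0:[X,\mathfrak{a}]=0\},$$ $$\mathfrak{b}=\mathfrak{g}_0\cap(\mathfrak{g}_0)_{\mathfrak{a}}^\perp=\{X\in\mathfrak{g}_0:\langle X,Y\rangle=0\ \text{for all}\ Y\in(\mathfrak{g}_0)_{\mathfrak{a}}\}.$$ Then $\mathfrak{m}$, regarded as a subspace of $\mathrm{Hom}(\mathfrak{a},\mathfrak{b})$ via the injective linear map $X\in\mathfrak{m}\mapsto-\mathrm{ad}_X\in\mathrm{Hom}(\mathfrak{a},\mathfrak{b})$, is a tableau over $\mathfrak{g}$.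 (It is called a Cartan tableau over $\mathfrak{g}$.)
   Context: **Tableaux over a Lie algebra.** Let $\mathfrak{g}$ be a finite dimensional Lie algebra over a field of characteristic zero, $\mathfrak{a},\mathfrak{b}\subset\mathfrak{g}$ vector subspaces with $\mathfrak{a}\cap\mathfrak{b}=\{0\}$, $k=\dim\mathfrak{a}$, and $\mathcal{A}\subset\mathrm{Hom}(\mathfrak{a},\mathfrak{b})$ a linear subspace. - Let $\rho:\mathrm{Hom}(\mathfrak{a},\mathcal{A})\to\mathfrak{b}\otimes\Lambda^2(\mathfrak{a}^* )$ be the linear map $\rho(F)(A_1,A_2)=\frac12\left(F(A_1)(A_2)-F(A_2)(A_1)\right)$. The first prolongation of $\mathcal{A}$ is $\mathcal{A}^{(1)}=\ker\rho$. - For a flag $\ell:(0)\subset\mathfrak{a}_1\subset\cdots\subset\mathfrak{a}_k=\mathfrak{a}$ (with $\dim\mathfrak{a}_j=j$) put $\mathcal{A}_j(\ell)=\{Q\in\mathcal{A}: Q|_{\mathfrak{a}_j}=0\}$. The flag $\ell$ is generic with respect to $\mathcal{A}$ if, for every $j$, $\dim\mathcal{A}_j(\ell)$ is the minimum of $\dim\mathcal{A}_j(\tilde\ell)$ over all such flags $\tilde\ell$ of $\mathfrak{a}$. The characters $s'_1,\dots,s'_k$ of $\mathcal{A}$ are defined by $s'_1+\cdots+s'_j=\dim\mathcal{A}-\dim\mathcal{A}_j(\ell)$, $j=1,\dots,k$, with $\ell$ generic. One always has $\dim\mathcal{A}^{(1)}\le s'_1+2s'_2+\cdots+ks'_k$;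 $\mathcal{A}$ is called involutive if equality holds. - For $Q\in\mathcal{A}$ and $A_1,A_2\in\mathfrak{a}$ let $R_Q(A_1,A_2)\in\mathfrak{g}/(\mathfrak{a}\oplus\mathfrak{b})$ be the class of $[A_1+Q(A_1),A_2+Q(A_2)]$. If $R_Q=0$, define $\tau_Q\in\mathfrak{b}\otimes\Lambda^2(\mathfrak{a}^* )$ by $\tau_Q(A_1,A_2)=[A_1+Q(A_1),A_2+Q(A_2)]_{\mathfrak{b}}-Q\left([A_1+Q(A_1),A_2+Q(A_2)]_{\mathfrak{a}}\right)$, where $X_{\mathfrak{a}},X_{\mathfrak{b}}$ are the components of $X\in\mathfrak{a}\oplus\mathfrak{b}$. - $\mathcal{A}$ is a tableau over $\mathfrak{g}$ if (1) $R_Q=0$ for each $Q\in\mathcal{A}$; (2) $\tau_Q\in\mathrm{Im}(\rho)$ for each $Q\in\mathcal{A}$; (3) $\mathcal{A}$ is involutive. **Facts asserted with the setup of the claim.** In the setting of the claim, $\mathfrak{g}_1$ decomposes as $\mathfrak{g}_1=\mathfrak{a}\oplus\mathfrak{m}$; for any regular element $A\in\mathfrak{a}$ with respect to the $\mathrm{Ad}(G_0)$-action on $\mathfrak{g}_1$ (that is, such that the $\mathrm{Ad}(G_0)$-orbit at $A$ is a principal orbit, $G_0$ being the group with Lie algebra $\mathfrak{g}_0$), the maps $\mathrm{ad}_A:\mathfrak{m}\to\mathfrak{b}$ and $\mathrm{ad}_A:\mathfrak{b}\to\mathfrak{m}$ are vector space isomorphisms; and the map $X\in\mathfrak{m}\mapsto-\mathrm{ad}_X\in\mathrm{Hom}(\mathfrak{a},\mathfrak{b})$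 is injective.
   Formalization: The decomposition g_1 = a ⊕ m, asserted in the paper's setting, is an explicit hypothesis (it fails e.g. for a spanned by a nilpotent element, where X ↦ −ad_X is not injective); the rank of g/g_0 is the dimension of maximal abelian subspaces with this property. *)

theory Defs
  imports Complex_Main "HOL-Library.Function_Algebras" "HOL-Library.Set_Algebras"
begin

section \<open>Spaces of linear maps out of a subspace\<close>

text \<open>
  A linear map out of a subspace \<open>V\<close> is represented by the function on the whole type that agrees
  with it on \<open>V\<close> and is \<open>0\<close> outside \<open>V\<close>.  Such functions are in linear bijection with the linear
  maps on \<open>V\<close>, so dimensions may be computed in the function space, with the pointwise addition
  of \<^theory>\<open>HOL-Library.Function_Algebras\<close> and the pointwise scaling \<open>fscale\<close>.
\<close>

definition fscale :: "('f \<Rightarrow> 'w \<Rightarrow> 'w) \<Rightarrow> 'f \<Rightarrow> ('v \<Rightarrow> 'w) \<Rightarrow> 'v \<Rightarrow> 'w" where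
  "fscale s c f = (\<lambda>x. s c (f x))"

lemma vector_space_fscale:
  assumes "vector_space s"
  shows "vector_space (fscale s)"
proof -
  interpret vector_space s by fact
  show ?thesis
    by unfold_locales
      (auto simp: fscale_def plus_fun_def fun_eq_iff scale_right_distrib scale_left_distrib)
qed

definition Hom ::
  "('f::field \<Rightarrow> 'v::ab_group_add \<Rightarrow> 'v) \<Rightarrow> ('f \<Rightarrow> 'w::ab_group_add \<Rightarrow> 'w)
    \<Rightarrow> 'v set \<Rightarrow> 'w set \<Rightarrow> ('v \<Rightarrow> 'w) set" where
  "Hom s t V W = {f. (\<forall>x\<in>V. f x \<in> W) \<and> (\<forall>x. x \<notin> V \<longrightarrow> f x = 0) \<and>
     (\<forall>x\<in>V. \<forall>y\<in>V. f (x + y) = f x + f y) \<and> (\<forall>c. \<forall>x\<in>V. f (s c x) = t c (f x))}"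

definition direct_sum :: "'v::ab_group_add set \<Rightarrow> 'v set \<Rightarrow> 'v set \<Rightarrow> bool" where
  "direct_sum U V W \<longleftrightarrow> U \<inter> V = {0} \<and> U + V = W"

definition component :: "'v::ab_group_add set \<Rightarrow> 'v set \<Rightarrow> 'v \<Rightarrow> 'v" where
  "component U V x = (THE u. u \<in> U \<and> (\<exists>v\<in>V. x = u + v))"


section \<open>Finite-dimensional Lie algebras\<close>

text \<open>
  The Lie algebra is the whole type \<open>'v\<close>.  The finite basis \<open>Basis\<close> is arbitrary; it only enters
  through the definition of the trace, which does not depend on it.
\<close>

locale lie_algebra = finite_dimensional_vector_space scale Basis
  for scale :: "'f::field_char_0 \<Rightarrow> 'v::ab_group_add \<Rightarrow> 'v" and Basis :: "'v set" +
  fixes bracket :: "'v \<Rightarrow> 'v \<Rightarrow> 'v"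
  assumes bracket_linear_left: "Vector_Spaces.linear scale scale (\<lambda>x. bracket x y)"
    and bracket_linear_right: "Vector_Spaces.linear scale scale (\<lambda>y. bracket x y)"
    and bracket_self: "bracket x x = 0"
    and jacobi: "bracket x (bracket y z) + bracket y (bracket z x) + bracket z (bracket x y) = 0"
begin

definition trace :: "('v \<Rightarrow> 'v) \<Rightarrow> 'f" where
  "trace f = (\<Sum>b\<in>Basis. representation Basis (f b) b)"

definition killing :: "'v \<Rightarrow> 'v \<Rightarrow> 'f" where
  "killing x y = trace (\<lambda>z. bracket x (bracket y z))"

text \<open>
  Semisimplicity as in Helgason's \<^emph>\<open>Differential Geometry, Lie Groups, and Symmetric Spaces\<close>:
  the Killing form is nondegenerate.
\<close>

definition semisimple :: bool where
  "semisimple \<longleftrightarrow> (\<forall>x. (\<forall>y. killing x y = 0) \<longrightarrow> x = 0)"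

definition perp :: "'v set \<Rightarrow> 'v set" where
  "perp U = {x. \<forall>y\<in>U. killing x y = 0}"


subsection \<open>Tableaux\<close>

text \<open>
  \<open>\<A>\<close> is a subspace of \<open>Hom(\<aa>, \<bb>)\<close>; elements of \<open>Hom(\<aa>, \<A>)\<close> and of \<open>\<bb> \<otimes> \<Lambda>\<^sup>2(\<aa>*)\<close> are both
  curried functions of two arguments, vanishing when an argument is outside \<open>\<aa>\<close>.
\<close>

definition rho :: "('v \<Rightarrow> 'v \<Rightarrow> 'v) \<Rightarrow> 'v \<Rightarrow> 'v \<Rightarrow> 'v" where
  "rho F A1 A2 = scale (1/2) (F A1 A2 - F A2 A1)"

abbreviation Hom_tableau :: "'v set \<Rightarrow> ('v \<Rightarrow> 'v) set \<Rightarrow> ('v \<Rightarrow> 'v \<Rightarrow> 'v) set" where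
  "Hom_tableau \<aa> \<A> \<equiv> Hom scale (fscale scale) \<aa> \<A>"

definition prolongation :: "'v set \<Rightarrow> ('v \<Rightarrow> 'v) set \<Rightarrow> ('v \<Rightarrow> 'v \<Rightarrow> 'v) set" where
  "prolongation \<aa> \<A> = {F \<in> Hom_tableau \<aa> \<A>. rho F = 0}"

definition flag :: "'v set \<Rightarrow> (nat \<Rightarrow> 'v set) \<Rightarrow> bool" where
  "flag \<aa> l \<longleftrightarrow> (\<forall>j\<le>dim \<aa>. subspace (l j) \<and> dim (l j) = j) \<and>
     (\<forall>j<dim \<aa>. l j \<subseteq> l (Suc j)) \<and> l (dim \<aa>) = \<aa>"

definition vanishing :: "('v \<Rightarrow> 'v) set \<Rightarrow> (nat \<Rightarrow> 'v set) \<Rightarrow> nat \<Rightarrow> ('v \<Rightarrow> 'v) set" where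
  "vanishing \<A> l j = {Q \<in> \<A>. \<forall>x\<in>l j. Q x = 0}"

abbreviation dim1 :: "('v \<Rightarrow> 'v) set \<Rightarrow> nat" where
  "dim1 \<equiv> vector_space.dim (fscale scale)"

abbreviation dim2 :: "('v \<Rightarrow> 'v \<Rightarrow> 'v) set \<Rightarrow> nat" where
  "dim2 \<equiv> vector_space.dim (fscale (fscale scale))"

definition generic_flag :: "'v set \<Rightarrow> ('v \<Rightarrow> 'v) set \<Rightarrow> (nat \<Rightarrow> 'v set) \<Rightarrow> bool" where
  "generic_flag \<aa> \<A> l \<longleftrightarrow> flag \<aa> l \<and>
     (\<forall>j\<in>{1..dim \<aa>}. \<forall>l'. flag \<aa> l' \<longrightarrow> dim1 (vanishing \<A> l j) \<le> dim1 (vanishing \<A> l' j))"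

text \<open>
  The equation below is \<open>s'\<^sub>1 + \<dots> + s'\<^sub>j = dim \<A> - dim \<A>\<^sub>j(l)\<close> without truncated subtraction.
\<close>

definition characters :: "'v set \<Rightarrow> ('v \<Rightarrow> 'v) set \<Rightarrow> (nat \<Rightarrow> nat) \<Rightarrow> bool" where
  "characters \<aa> \<A> s \<longleftrightarrow> (\<exists>l. generic_flag \<aa> \<A> l \<and>
     (\<forall>j\<in>{1..dim \<aa>}. (\<Sum>i=1..j. s i) + dim1 (vanishing \<A> l j) = dim1 \<A>))"

definition involutive :: "'v set \<Rightarrow> ('v \<Rightarrow> 'v) set \<Rightarrow> bool" where
  "involutive \<aa> \<A> \<longleftrightarrow> (\<exists>s. characters \<aa> \<A> s \<and>
     dim2 (prolongation \<aa> \<A>) = (\<Sum>j=1..dim \<aa>. j * s j))"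

definition graph_bracket :: "('v \<Rightarrow> 'v) \<Rightarrow> 'v \<Rightarrow> 'v \<Rightarrow> 'v" where
  "graph_bracket Q A1 A2 = bracket (A1 + Q A1) (A2 + Q A2)"

text \<open>\<open>R_Q(A\<^sub>1, A\<^sub>2)\<close> is a coset of \<open>\<aa> + \<bb>\<close>; the zero class is \<open>\<aa> + \<bb>\<close> itself.\<close>

definition curvature :: "'v set \<Rightarrow> 'v set \<Rightarrow> ('v \<Rightarrow> 'v) \<Rightarrow> 'v \<Rightarrow> 'v \<Rightarrow> 'v set" where
  "curvature \<aa> \<bb> Q A1 A2 = graph_bracket Q A1 A2 +o (\<aa> + \<bb>)"

definition torsion :: "'v set \<Rightarrow> 'v set \<Rightarrow> ('v \<Rightarrow> 'v) \<Rightarrow> 'v \<Rightarrow> 'v \<Rightarrow> 'v" where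
  "torsion \<aa> \<bb> Q A1 A2 =
     (if A1 \<in> \<aa> \<and> A2 \<in> \<aa>
      then component \<bb> \<aa> (graph_bracket Q A1 A2) - Q (component \<aa> \<bb> (graph_bracket Q A1 A2))
      else 0)"

definition tableau_over :: "'v set \<Rightarrow> 'v set \<Rightarrow> ('v \<Rightarrow> 'v) set \<Rightarrow> bool" where
  "tableau_over \<aa> \<bb> \<A> \<longleftrightarrow>
     subspace \<aa> \<and> subspace \<bb> \<and> \<aa> \<inter> \<bb> = {0} \<and>
     \<A> \<subseteq> Hom scale scale \<aa> \<bb> \<and> module.subspace (fscale scale) \<A> \<and>
     (\<forall>Q\<in>\<A>. \<forall>A1\<in>\<aa>. \<forall>A2\<in>\<aa>. curvature \<aa> \<bb> Q A1 A2 = \<aa> + \<bb>) \<and>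
     (\<forall>Q\<in>\<A>. torsion \<aa> \<bb> Q \<in> rho ` Hom_tableau \<aa> \<A>) \<and>
     involutive \<aa> \<A>"


subsection \<open>Symmetric decompositions\<close>

definition symmetric_decomposition :: "'v set \<Rightarrow> 'v set \<Rightarrow> bool" where
  "symmetric_decomposition \<gg>0 \<gg>1 \<longleftrightarrow>
     subspace \<gg>0 \<and> subspace \<gg>1 \<and> direct_sum \<gg>0 \<gg>1 UNIV \<and>
     (\<forall>x\<in>\<gg>0. \<forall>y\<in>\<gg>0. bracket x y \<in> \<gg>0) \<and>
     (\<forall>x\<in>\<gg>0. \<forall>y\<in>\<gg>1. bracket x y \<in> \<gg>1) \<and>
     (\<forall>x\<in>\<gg>1. \<forall>y\<in>\<gg>1. bracket x y \<in> \<gg>0)"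

definition abelian_subspace :: "'v set \<Rightarrow> 'v set \<Rightarrow> bool" where
  "abelian_subspace V \<aa> \<longleftrightarrow> subspace \<aa> \<and> \<aa> \<subseteq> V \<and> (\<forall>x\<in>\<aa>. \<forall>y\<in>\<aa>. bracket x y = 0)"

definition maximal_abelian :: "'v set \<Rightarrow> 'v set \<Rightarrow> bool" where
  "maximal_abelian V \<aa> \<longleftrightarrow> abelian_subspace V \<aa> \<and>
     (\<forall>\<aa>'. abelian_subspace V \<aa>' \<and> \<aa> \<subseteq> \<aa>' \<longrightarrow> \<aa>' = \<aa>)"

definition orth_part :: "'v set \<Rightarrow> 'v set \<Rightarrow> 'v set" where
  "orth_part \<gg>1 \<aa> = perp \<aa> \<inter> \<gg>1"

definition centralizer :: "'v set \<Rightarrow> 'v set \<Rightarrow> 'v set" where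
  "centralizer \<gg>0 \<aa> = {x \<in> \<gg>0. \<forall>y\<in>\<aa>. bracket x y = 0}"

definition cartan_b :: "'v set \<Rightarrow> 'v set \<Rightarrow> 'v set" where
  "cartan_b \<gg>0 \<aa> = \<gg>0 \<inter> perp (centralizer \<gg>0 \<aa>)"

text \<open>
  The rank of \<open>\<gg>/\<gg>\<^sub>0\<close> is the common dimension of the maximal abelian subspaces \<open>\<aa>\<close> of \<open>\<gg>\<^sub>1\<close> with
  \<open>\<gg>\<^sub>1 = \<aa> \<oplus> (\<aa>\<^sup>\<bottom> \<inter> \<gg>\<^sub>1)\<close>.  The splitting is automatic when the Killing form is definite on \<open>\<gg>\<^sub>1\<close>
  (the Riemannian case).  In general it rules out, for instance, the span of a nilpotent element,
  and leaves exactly the maximal abelian subspaces that consist of semisimple elements.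
\<close>

definition symmetric_rank :: "'v set \<Rightarrow> nat" where
  "symmetric_rank \<gg>1 =
     Max (dim ` {\<aa>. maximal_abelian \<gg>1 \<aa> \<and> direct_sum \<aa> (orth_part \<gg>1 \<aa>) \<gg>1})"

definition neg_ad :: "'v set \<Rightarrow> 'v \<Rightarrow> 'v \<Rightarrow> 'v" where
  "neg_ad \<aa> x = (\<lambda>A. if A \<in> \<aa> then - bracket x A else 0)"

end

end

theory Submission
  imports Defs "HOL-Computational_Algebra.Polynomial"
begin

text \<open>
  Everything hinges on \<open>ker (ad A)\<^sup>2 = ker (ad A)\<close> for \<open>A \<in> \<aa>\<close>, which is proved over an arbitrary field
  of characteristic zero without Jordan decomposition.  There is a polynomial \<open>\<nu>\<close> with \<open>N = \<nu>(ad A)\<close>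
  nilpotent and \<open>\<nu>'(ad A) = 1\<close>.  The functional \<open>z \<mapsto> tr (N \<circ> ad z)\<close> vanishes on \<open>\<gg>\<^sub>1\<close>: the element
  representing it centralizes \<open>\<aa>\<close>, hence lies in \<open>\<aa>\<close> by maximality, and is orthogonal to \<open>\<aa>\<close> because
  traces of nilpotent maps vanish.  If \<open>[A, [A, z]] = 0\<close> then \<open>ad [A, z] = [N, ad z]\<close>, so \<open>[A, z]\<close> is
  orthogonal to everything.

  An \<open>A\<^sub>0 \<in> \<aa>\<close> whose kernel has minimal dimension then centralizes only what all of \<open>\<aa>\<close> centralizes, and
  \<open>ad A\<^sub>0\<close> is bijective from \<open>\<mm>\<close> to \<open>\<bb>\<close> and injective on \<open>\<bb>\<close>.  A flag that starts with \<open>A\<^sub>0\<close> kills the whole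
  tableau in the first step, so \<open>s'\<^sub>1 = dim \<mm>\<close> and the other characters vanish; and \<open>X \<in> \<mm>\<close> corresponds
  to the element \<open>A \<mapsto> - ad (ad A\<^sub>0)\<^sup>-\<^sup>1 [A, X]\<close> of the prolongation.  The bracket of two
  elements of the graph of \<open>- ad X\<close> is \<open>[[A\<^sub>1, X], [A\<^sub>2, X]]\<close>, which lies in \<open>\<bb>\<close>.
\<close>

section \<open>Polynomials in an endomorphism\<close>

abbreviation endo :: "('f::field \<Rightarrow> 'v::ab_group_add \<Rightarrow> 'v) \<Rightarrow> ('v \<Rightarrow> 'v) \<Rightarrow> bool" where
  "endo s \<equiv> Vector_Spaces.linear s s"

text \<open>This is \<open>q(T)\<close>, evaluated by Horner's rule so that induction over
  \<open>pCons\<close> applies.\<close>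

definition poly_map ::
  "('f::field \<Rightarrow> 'v::ab_group_add \<Rightarrow> 'v) \<Rightarrow> ('v \<Rightarrow> 'v) \<Rightarrow> 'f poly \<Rightarrow> 'v \<Rightarrow> 'v" where
  "poly_map s T q = fold_coeffs (\<lambda>a g x. s a x + T (g x)) q (\<lambda>_. 0)"

context vector_space
begin

lemma endo_iff: "endo scale f \<longleftrightarrow> (\<forall>x y. f (x + y) = f x + f y) \<and> (\<forall>c x. f (scale c x) = scale c (f x))"
  unfolding Vector_Spaces.linear_iff using vector_space_axioms by blast

lemma endo_add: "endo scale f \<Longrightarrow> f (x + y) = f x + f y" by (simp add: endo_iff)
lemma endo_scale: "endo scale f \<Longrightarrow> f (scale c x) = scale c (f x)" by (simp add: endo_iff)
lemma endo_0: "endo scale f \<Longrightarrow> f 0 = 0" using endo_scale[of f 0 0] by simp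
lemma endo_neg: "endo scale f \<Longrightarrow> f (- x) = - f x" using endo_scale[of f "-1" x] by simp
lemma endo_diff: "endo scale f \<Longrightarrow> f (x - y) = f x - f y" using endo_add[of f x "-y"] endo_neg[of f y] by simp
lemma endo_sum: "endo scale f \<Longrightarrow> f (sum g S) = (\<Sum>i\<in>S. f (g i))"
  by (induction S rule: infinite_finite_induct) (auto simp: endo_0 endo_add)

lemmas endo_simps = endo_add endo_scale endo_0 endo_neg endo_diff

lemma endo_comp: "endo scale f \<Longrightarrow> endo scale g \<Longrightarrow> endo scale (\<lambda>x. f (g x))"
  by (simp add: endo_iff)
lemma endo_id: "endo scale (\<lambda>x. x)" by (simp add: endo_iff)
lemma endo_minus: "endo scale f \<Longrightarrow> endo scale g \<Longrightarrow> endo scale (\<lambda>x. f x - g x)"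
  by (simp add: endo_iff algebra_simps)
lemma endo_funpow: "endo scale f \<Longrightarrow> endo scale (f ^^ n)"
  by (induction n) (simp_all add: endo_iff)

lemma poly_map_0 [simp]: "poly_map scale T 0 x = 0"
  by (simp add: poly_map_def)

lemma poly_map_pCons:
  "endo scale T \<Longrightarrow> poly_map scale T (pCons a q) x = scale a x + T (poly_map scale T q x)"
  by (cases "a = 0 \<and> q = 0")
     (auto simp: poly_map_def fold_coeffs_pCons_not_0_0_eq endo_0)

lemma endo_poly_map: "endo scale T \<Longrightarrow> endo scale (poly_map scale T q)"
proof (induction q)
  case 0 show ?case by (simp add: endo_iff)
next
  case (pCons a q)
  then have "poly_map scale T (pCons a q) = (\<lambda>x. scale a x + T (poly_map scale T q x))"
    by (auto simp: poly_map_pCons)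
  with pCons show ?case by (simp add: endo_iff algebra_simps)
qed

lemma poly_map_add: "endo scale T \<Longrightarrow> poly_map scale T (p + q) x = poly_map scale T p x + poly_map scale T q x"
  by (induction p q rule: poly_induct2) (simp_all add: poly_map_pCons endo_simps algebra_simps)

lemma poly_map_smult: "endo scale T \<Longrightarrow> poly_map scale T (smult c q) x = scale c (poly_map scale T q x)"
  by (induction q) (simp_all add: poly_map_pCons endo_simps algebra_simps)

lemma poly_map_mult: "endo scale T \<Longrightarrow> poly_map scale T (p * q) x = poly_map scale T p (poly_map scale T q x)"
  by (induction p) (simp_all add: poly_map_pCons poly_map_add poly_map_smult)

lemma poly_map_diff: "endo scale T \<Longrightarrow> poly_map scale T (p - q) x = poly_map scale T p x - poly_map scale T q x"
  using poly_map_add[of T "p - q" q x] by simp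

lemma poly_map_1: "endo scale T \<Longrightarrow> poly_map scale T 1 x = x"
  by (simp add: one_pCons poly_map_pCons endo_0)

lemma poly_map_power: "endo scale T \<Longrightarrow> poly_map scale T (p ^ n) x = (poly_map scale T p ^^ n) x"
  by (induction n arbitrary: x) (simp_all add: poly_map_1 poly_map_mult)

lemma poly_map_commute:
  assumes "endo scale T" "endo scale M" "\<And>x. T (M x) = M (T x)"
  shows "poly_map scale T q (M x) = M (poly_map scale T q x)"
  using assms by (induction q) (simp_all add: poly_map_pCons endo_simps)

text \<open>Since \<open>C\<close>, the commutator of \<open>T\<close> and \<open>M\<close>,
  commutes with \<open>T\<close>, taking the commutator with \<open>M\<close> acts on polynomials in
  \<open>T\<close> as a derivation sending \<open>T\<close> to \<open>C\<close>. If
  \<open>pderiv q\<close> acts as the identity, \<open>C\<close> itself becomes the commutator of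
  \<open>q(T)\<close> with \<open>M\<close>.\<close>

lemma poly_map_commutator:
  assumes T: "endo scale T" and M: "endo scale M"
    and C: "\<And>x. C x = T (M x) - M (T x)" and TC: "\<And>x. T (C x) = C (T x)"
  shows "poly_map scale T q (M x) - M (poly_map scale T q x) = poly_map scale T (pderiv q) (C x)"
proof (induction q)
  case 0 then show ?case using M by (simp add: endo_0)
next
  case (pCons a q)
  have "endo scale C" using C endo_minus[OF endo_comp[OF T M] endo_comp[OF M T]] by presburger
  have *: "T (poly_map scale T q (M x)) = T (M (poly_map scale T q x)) + T (poly_map scale T (pderiv q) (C x))"
    using pCons.IH T by (metis endo_add diff_add_cancel add.commute)
  have **: "poly_map scale T q (C x) = C (poly_map scale T q x)"
    by (rule poly_map_commute) (use T \<open>endo scale C\<close> TC in auto)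
  show ?case
    using C[of "poly_map scale T q x"]
    by (simp add: poly_map_pCons T M poly_map_add pderiv_pCons endo_simps * ** algebra_simps)
qed

end

section \<open>Divisibility of polynomials in characteristic zero\<close>

lemma pderiv_dvd_power_aux:
  fixes d e :: "'a::field_char_0 poly"
  assumes "d dvd pderiv d * e"
  shows "d dvd (pderiv ^^ j) d * e ^ j"
proof (induction j)
  case 0 show ?case by simp
next
  case (Suc j)
  then obtain g where g: "(pderiv ^^ j) d * e ^ j = d * g" by (auto simp: dvd_def)
  let ?X = "(pderiv ^^ j) d"
  have e: "pderiv (e ^ j) * e = of_nat j * pderiv e * e ^ j"
  proof (cases j)
    case (Suc i)
    then show ?thesis
      by (simp add: pderiv_power_Suc of_nat_poly del: power_Suc of_nat_Suc) (simp add: mult_ac)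
  qed simp
  \<comment> \<open>Differentiating and multiplying by \<open>e\<close> trades one derivative of
    \<open>d\<close> for one factor \<open>e\<close>; the term \<open>g * (pderiv d * e)\<close> is
    a multiple of \<open>d\<close> by assumption.\<close>
  have "pderiv (?X * e ^ j) * e = pderiv (d * g) * e" using g by simp
  then have "?X * (pderiv (e ^ j) * e) + pderiv ?X * (e ^ j * e) = (d * pderiv g + g * pderiv d) * e"
    by (simp only: pderiv_mult) (simp add: algebra_simps)
  then have "pderiv ?X * (e ^ j * e)
      = (d * pderiv g + g * pderiv d) * e - of_nat j * pderiv e * (?X * e ^ j)"
    unfolding e by (simp add: algebra_simps)
  then have "(pderiv ^^ Suc j) d * e ^ Suc j
      = d * (pderiv g * e - of_nat j * pderiv e * g) + g * (pderiv d * e)"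
    unfolding g by (simp add: algebra_simps)
  then show ?case using assms by simp
qed

lemma degree_funpow_pderiv:
  fixes d :: "'a::field_char_0 poly"
  shows "degree ((pderiv ^^ j) d) = degree d - j"
  by (induction j) (simp_all add: degree_pderiv)

text \<open>In characteristic zero the derivative of \<open>d\<close> of order
  \<open>degree d\<close> is a nonzero constant, so in \<open>pderiv_dvd_power_aux\<close> only the
  power of \<open>e\<close> remains.\<close>

lemma dvd_power_degree:
  fixes d e :: "'a::field_char_0 poly"
  assumes "d dvd pderiv d * e" "d \<noteq> 0"
  shows "d dvd e ^ degree d"
proof -
  have nz: "(pderiv ^^ j) d \<noteq> 0" if "j \<le> degree d" for j
    using that
  proof (induction j)
    case (Suc j)
    then have "degree ((pderiv ^^ j) d) \<noteq> 0" by (simp add: degree_funpow_pderiv)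
    then show ?case by (simp add: pderiv_eq_0_iff)
  qed (use assms in simp)
  obtain c where c: "(pderiv ^^ degree d) d = [:c:]"
    using degree_funpow_pderiv[of "degree d" d] by (metis degree_eq_zeroE diff_self_eq_0)
  with nz[of "degree d"] have "c \<noteq> 0" by auto
  with pderiv_dvd_power_aux[OF assms(1), of "degree d"] show ?thesis
    by (simp add: c dvd_smult_iff)
qed

text \<open>A nonzero combination of \<open>p\<close> and \<open>q\<close> of least degree divides
  every combination, because the remainder is again a combination, of smaller degree.\<close>

lemma poly_bezout:
  fixes p q :: "'a::field poly"
  assumes "p \<noteq> 0"
  obtains d u v where "d = u * p + v * q" "d dvd p" "d dvd q" "d \<noteq> 0"
proof -
  define P where "P d \<longleftrightarrow> d \<noteq> 0 \<and> (\<exists>u v. d = u * p + v * q)" for d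
  have "P p" unfolding P_def using assms by (metis add.right_neutral mult_1 mult_zero_left)
  then obtain d where d: "P d" and min: "\<And>d'. P d' \<Longrightarrow> degree d \<le> degree d'"
    using ex_has_least_nat[of P p degree] by blast
  obtain u v where uv: "d = u * p + v * q" using d by (auto simp: P_def)
  have dvd: "d dvd a * p + b * q" for a b
  proof (rule ccontr)
    assume "\<not> ?thesis"
    then have nz: "(a * p + b * q) mod d \<noteq> 0" by (simp add: dvd_eq_mod_eq_0)
    have "(a * p + b * q) mod d = (a * p + b * q) - (a * p + b * q) div d * d"
      by (simp add: minus_div_mult_eq_mod)
    also have "\<dots> = (a - (a * p + b * q) div d * u) * p + (b - (a * p + b * q) div d * v) * q"
      using arg_cong[OF uv, of "\<lambda>x. (a * p + b * q) div d * x"] by (simp add: algebra_simps)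
    finally have "P ((a * p + b * q) mod d)" using nz unfolding P_def by blast
    with min have "degree d \<le> degree ((a * p + b * q) mod d)" by blast
    moreover have "degree ((a * p + b * q) mod d) < degree d"
      using nz d degree_mod_less[of d] by (auto simp: P_def)
    ultimately show False by simp
  qed
  show ?thesis using that[OF uv] dvd[of 1 0] dvd[of 0 1] d by (auto simp: P_def)
qed

text \<open>If \<open>p(T) ^ j = 0\<close>, the first divisibility makes \<open>\<nu>(T)\<close>
  nilpotent and the second makes \<open>pderiv \<nu>\<close> act as the identity. The proof is a
  Hensel-type iteration in which the error gains one factor \<open>p\<close> per step.\<close>

lemma ex_nilpotent_correction:
  fixes p :: "'a::field_char_0 poly"
  assumes uv: "u * p + v * pderiv p = 1"
  shows "\<exists>\<nu>. p dvd \<nu> \<and> p ^ j dvd pderiv \<nu> - 1"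
proof (induction j)
  case 0 show ?case by (intro exI[of _ 0]) simp
next
  case (Suc j)
  then obtain \<nu> g where \<nu>: "p dvd \<nu>" and g: "pderiv \<nu> - 1 = p ^ j * g" by (auto simp: dvd_def)
  \<comment> \<open>Modulo \<open>p ^ Suc j\<close> the derivative of \<open>r * p ^ Suc j\<close>
    is \<open>- v * g * pderiv p * p ^ j\<close>. This cancels the error \<open>p ^ j * g\<close>,
    because \<open>v * pderiv p\<close> is \<open>1\<close> modulo \<open>p\<close>.\<close>
  define r where "r = smult (- inverse (of_nat (Suc j))) (v * g)"
  have r: "of_nat (Suc j) * r = - (v * g)"
    unfolding r_def by (simp add: of_nat_poly del: of_nat_Suc)
  have pd: "pderiv (p ^ Suc j) = of_nat (Suc j) * (p ^ j * pderiv p)"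
    by (simp add: pderiv_power_Suc of_nat_poly del: of_nat_Suc power_Suc)
  have "pderiv (\<nu> + r * p ^ Suc j) - 1
      = p ^ j * g + (of_nat (Suc j) * r) * (p ^ j * pderiv p) + p ^ Suc j * pderiv r"
    using g by (simp only: pderiv_add pderiv_mult pd) (simp add: algebra_simps)
  also have "\<dots> = p ^ j * (g * (1 - v * pderiv p)) + p ^ Suc j * pderiv r"
    unfolding r by (simp add: algebra_simps)
  also have "\<dots> = p ^ Suc j * (g * u + pderiv r)"
    unfolding uv[symmetric] by (simp add: algebra_simps)
  finally have "p ^ Suc j dvd pderiv (\<nu> + r * p ^ Suc j) - 1" by simp
  moreover have "p dvd \<nu> + r * p ^ Suc j" using \<nu> by simp
  ultimately show ?case by blast
qed

section \<open>Annihilating polynomials of an endomorphism\<close>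

context vector_space
begin

lemma poly_map_monom: "endo scale T \<Longrightarrow> poly_map scale T (monom c n) x = scale c ((T ^^ n) x)"
  by (induction n) (simp_all add: monom_0 monom_Suc poly_map_pCons endo_simps)

lemma poly_map_sum:
  "endo scale T \<Longrightarrow> poly_map scale T (\<Sum>i\<in>I. q i) x = (\<Sum>i\<in>I. poly_map scale T (q i) x)"
  by (induction I rule: infinite_finite_induct) (simp_all add: poly_map_add)

lemma poly_map_dvd_eq_0:
  assumes "endo scale T" "p dvd q" "\<And>x. poly_map scale T p x = 0"
  shows "poly_map scale T q x = 0"
proof -
  obtain r where "q = r * p" using assms(2) by (metis dvd_def mult.commute)
  then show ?thesis using assms by (simp add: poly_map_mult endo_0[OF endo_poly_map])
qed

end

context finite_dimensional_vector_space
begin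

lemma endo_surj_on_subspace:
  assumes f: "endo scale f" and V: "subspace V" and inj: "\<And>x. x \<in> V \<Longrightarrow> f x = 0 \<Longrightarrow> x = 0"
    and sub: "f ` V \<subseteq> V"
  shows "f ` V = V"
proof (rule subspace_dim_equal)
  interpret finite_dimensional_vector_space_pair_1 scale Basis scale by unfold_locales
  have "inj_on f V"
  proof (rule inj_onI)
    fix x y assume "x \<in> V" "y \<in> V" "f x = f y"
    then have "x - y = 0" using inj[of "x - y"] by (simp add: subspace_diff V endo_diff[OF f])
    then show "x = y" by simp
  qed
  then show "dim V \<le> dim (f ` V)"
    using dim_image_eq[OF f, of V] span_eq_iff[THEN iffD2, OF V] by simp
  show "subspace (f ` V)" by (rule linear_subspace_image[OF f V])
qed (use V sub in auto)

text \<open>A family is used instead of a set so that repeated vectors count as dependent; the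
  vectors \<open>(T ^^ j) v\<close> may repeat.\<close>

lemma ex_linear_dependence:
  fixes w :: "nat \<Rightarrow> 'b"
  shows "\<exists>c. (\<Sum>j\<le>dimension. scale (c j) (w j)) = 0 \<and> (\<exists>i\<le>dimension. c i \<noteq> 0)"
proof (cases "inj_on w {..dimension}")
  case True
  have "dependent (w ` {..dimension})"
  proof (rule ccontr)
    assume "independent (w ` {..dimension})"
    then have "card (w ` {..dimension}) \<le> dimension"
      using independent_bound_general dim_subset_UNIV order_trans by blast
    then show False by (simp add: card_image True)
  qed
  then obtain u v where u: "v \<in> w ` {..dimension}" "u v \<noteq> 0" "(\<Sum>v\<in>w ` {..dimension}. scale (u v) v) = 0"
    by (auto simp: dependent_finite)
  then have "(\<Sum>j\<le>dimension. scale (u (w j)) (w j)) = 0"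
    by (simp add: sum.reindex True)
  with u show ?thesis by (intro exI[of _ "u \<circ> w"]) auto
next
  case False
  then obtain i j where ij: "i \<le> dimension" "j \<le> dimension" "w i = w j" "i \<noteq> j"
    by (auto simp: inj_on_def)
  let ?c = "\<lambda>k. (if k = i then 1 else 0) - (if k = j then 1 else 0) :: 'a"
  have "(\<Sum>k\<le>dimension. scale (?c k) (w k)) = 0"
    using ij by (simp add: scale_left_diff_distrib sum_subtractf if_distrib[of "\<lambda>c. scale c _"] cong: if_cong)
  moreover have "?c i \<noteq> 0" using ij by simp
  ultimately show ?thesis using ij(1) by (intro exI[of _ ?c]) blast
qed

lemma ex_poly_map_vanishing_at:
  assumes T: "endo scale T"
  shows "\<exists>f. f \<noteq> 0 \<and> poly_map scale T f v = 0"
proof -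
  obtain c i where c: "(\<Sum>j\<le>dimension. scale (c j) ((T ^^ j) v)) = 0" "i \<le> dimension" "c i \<noteq> 0"
    using ex_linear_dependence[of "\<lambda>j. (T ^^ j) v"] by blast
  define f where "f = (\<Sum>j\<le>dimension. monom (c j) j)"
  have "coeff f i = c i" using c(2) by (simp add: f_def coeff_sum if_distrib cong: if_cong)
  moreover have "poly_map scale T f v = 0"
    using c(1) by (simp add: f_def poly_map_sum poly_map_monom T)
  ultimately show ?thesis using c(3) by (intro exI[of _ f]) auto
qed

text \<open>Polynomials in \<open>T\<close> commute, so the product of polynomials killing the
  single basis vectors kills everything.\<close>

lemma ex_poly_map_eq_0:
  assumes T: "endo scale T"
  shows "\<exists>f. f \<noteq> 0 \<and> (\<forall>x. poly_map scale T f x = 0)"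
proof -
  obtain f where f: "\<And>b. f b \<noteq> 0" "\<And>b. poly_map scale T (f b) b = 0"
    using ex_poly_map_vanishing_at[OF T] by metis
  define q where "q = (\<Prod>b\<in>Basis. f b)"
  have qB: "poly_map scale T q b = 0" if "b \<in> Basis" for b
  proof -
    have "q = (\<Prod>b\<in>Basis - {b}. f b) * f b"
      unfolding q_def using that finite_Basis by (subst prod.remove[of _ b]) (auto simp: mult.commute)
    then show ?thesis by (simp add: poly_map_mult T f endo_0[OF endo_poly_map[OF T]])
  qed
  then have "poly_map scale T q x = 0" for x
  proof -
    have "x \<in> span Basis" using span_Basis by simp
    then show ?thesis
      by (induction rule: span_induct_alt)
         (simp_all add: endo_simps[OF endo_poly_map[OF T]] qB)
  qed
  moreover have "q \<noteq> 0" unfolding q_def using f finite_Basis by simp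
  ultimately show ?thesis by blast
qed

end

text \<open>A nonzero \<open>p\<close> of minimal degree with \<open>p(T)\<close> nilpotent is coprime to \<open>p'\<close>: if \<open>p = d e\<close> with \<open>d\<close> the
  greatest common divisor of \<open>p\<close> and \<open>p'\<close>, then \<open>p\<close> divides a power of \<open>e\<close>.\<close>

lemma (in lie_algebra) ex_nilpotent_poly_map:
  assumes T: "endo scale T"
  obtains \<nu> n where "\<And>x. (poly_map scale T \<nu> ^^ n) x = 0"
    and "\<And>x. poly_map scale T (pderiv \<nu>) x = x"
proof -
  define P where "P p \<longleftrightarrow> p \<noteq> 0 \<and> (\<exists>n. \<forall>x. poly_map scale T (p ^ n) x = 0)" for p
  obtain f where "f \<noteq> 0" "\<And>x. poly_map scale T f x = 0" using ex_poly_map_eq_0[OF T] by blast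
  then have "P f" unfolding P_def by (metis power_one_right)
  then obtain p where p: "P p" and min: "\<And>q. P q \<Longrightarrow> degree p \<le> degree q"
    using ex_has_least_nat[of P f degree] by blast
  from p obtain n where "p \<noteq> 0" and n: "\<And>x. poly_map scale T (p ^ n) x = 0"
    by (auto simp: P_def)
  obtain d u v where d: "d = u * p + v * pderiv p" "d dvd p" "d dvd pderiv p" "d \<noteq> 0"
    using poly_bezout[OF \<open>p \<noteq> 0\<close>] by metis
  from d obtain e where e: "p = d * e" by (auto simp: dvd_def)
  have "e \<noteq> 0" using \<open>p \<noteq> 0\<close> e by auto
  have "pderiv p = d * pderiv e + pderiv d * e" by (simp add: e pderiv_mult algebra_simps)
  then have "d dvd pderiv d * e" using d(3) by (metis dvd_add_right_iff dvd_triv_left)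
  then have "d dvd e ^ degree d" using d(4) by (rule dvd_power_degree)
  then have "p dvd e ^ Suc (degree d)" unfolding e by (simp add: mult.commute mult_dvd_mono)
  then have "p ^ n dvd e ^ (Suc (degree d) * n)" unfolding power_mult by (rule dvd_power_same)
  then have "poly_map scale T (e ^ (Suc (degree d) * n)) x = 0" for x
    by (rule poly_map_dvd_eq_0[OF T _ n])
  with \<open>e \<noteq> 0\<close> have "P e" unfolding P_def by blast
  \<comment> \<open>Minimality of \<open>p\<close> leaves no room for a nonconstant
    \<open>d\<close>, so \<open>p\<close> and \<open>pderiv p\<close> are coprime.\<close>
  then have "degree p \<le> degree e" by (rule min)
  moreover have "degree p = degree d + degree e"
    unfolding e using d(4) \<open>e \<noteq> 0\<close> by (rule degree_mult_eq)
  ultimately have "degree d = 0" by simp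
  then obtain c where c: "d = [:c:]" by (metis degree_eq_zeroE)
  with d(4) have "c \<noteq> 0" by auto
  have "smult (inverse c) u * p + smult (inverse c) v * pderiv p = smult (inverse c) d"
    unfolding arg_cong[OF d(1), of "smult (inverse c)"] by (simp add: smult_add_right)
  also have "\<dots> = 1" unfolding c using \<open>c \<noteq> 0\<close> by (simp add: one_pCons)
  finally have "\<exists>\<nu>. p dvd \<nu> \<and> p ^ n dvd pderiv \<nu> - 1" by (rule ex_nilpotent_correction)
  then obtain \<nu> where \<nu>: "p dvd \<nu>" "p ^ n dvd pderiv \<nu> - 1" by blast
  show thesis
  proof (rule that[of n \<nu>])
    fix x
    have "p ^ n dvd \<nu> ^ n" using \<nu>(1) by (rule dvd_power_same)
    then have "poly_map scale T (\<nu> ^ n) x = 0" by (rule poly_map_dvd_eq_0[OF T _ n])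
    then show "(poly_map scale T \<nu> ^^ n) x = 0" by (simp add: poly_map_power T)
    show "poly_map scale T (pderiv \<nu>) x = x"
      using poly_map_dvd_eq_0[OF T \<nu>(2) n, of x] by (simp add: poly_map_diff poly_map_1 T)
  qed
qed

section \<open>The trace\<close>

context lie_algebra
begin

lemma trace_add: "trace (\<lambda>x. f x + g x) = trace f + trace g"
  by (simp add: trace_def representation_add independent_Basis span_Basis sum.distrib)

lemma trace_scale: "trace (\<lambda>x. scale c (f x)) = c * trace f"
  by (simp add: trace_def representation_scale independent_Basis span_Basis sum_distrib_left)

lemma trace_0: "trace (\<lambda>x. 0) = 0"
  by (simp add: trace_def representation_zero)

lemma trace_diff: "trace (\<lambda>x. f x - g x) = trace f - trace g"
  by (simp add: trace_def representation_diff independent_Basis span_Basis sum_subtractf)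

lemma trace_comp_commute:
  assumes f: "endo scale f" and g: "endo scale g"
  shows "trace (\<lambda>x. f (g x)) = trace (\<lambda>x. g (f x))"
proof -
  have *: "trace (\<lambda>x. f (g x))
    = (\<Sum>b\<in>Basis. \<Sum>c\<in>Basis. representation Basis (g b) c * representation Basis (f c) b)"
    if f: "endo scale f" for f g
    unfolding trace_def
  proof (rule sum.cong[OF refl])
    fix b assume "b \<in> Basis"
    have "g b = (\<Sum>c\<in>Basis. scale (representation Basis (g b) c) c)"
      by (rule sum_representation_eq[symmetric]) (simp_all add: independent_Basis span_Basis finite_Basis)
    then have "f (g b) = (\<Sum>c\<in>Basis. scale (representation Basis (g b) c) (f c))"
      by (metis (no_types, lifting) endo_scale[OF f] endo_sum[OF f] sum.cong)
    then show "representation Basis (f (g b)) b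
      = (\<Sum>c\<in>Basis. representation Basis (g b) c * representation Basis (f c) b)"
      by (simp add: representation_sum representation_scale independent_Basis span_Basis)
  qed
  show ?thesis
    unfolding *[OF f, of g] *[OF g, of f] by (subst sum.swap) (simp add: mult.commute)
qed

text \<open>Induction on the nilpotency index. Subtracting \<open>P o X\<close>, with
  \<open>P\<close> a projection onto the kernel of \<open>X\<close>, lowers the index by one and
  keeps the trace, since \<open>P o X\<close> and \<open>X o P = 0\<close> have the same
  trace.\<close>

lemma trace_nilpotent:
  assumes "endo scale X" "\<And>x. (X ^^ n) x = 0"
  shows "trace X = 0"
  using assms
proof (induction n arbitrary: X)
  case 0
  then have "X = (\<lambda>x. 0)" by auto
  then show ?case using trace_0 by simp
next
  case (Suc n)
  note X = \<open>endo scale X\<close>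
  interpret vector_space_pair scale scale by unfold_locales
  have "subspace {x. X x = 0}" by (auto simp: subspace_def endo_simps[OF X])
  then obtain P where P: "range P \<subseteq> {x. X x = 0}" "endo scale P" "\<And>x. X x = 0 \<Longrightarrow> P x = x"
    using linear_exists_left_inverse_on[of "\<lambda>x. x" "{x. X x = 0}"] endo_id by (auto simp: inj_on_def)
  have XP: "X (P x) = 0" for x using P(1) by auto
  define Y where "Y x = X x - P (X x)" for x
  have "Y = (\<lambda>x. X x - P (X x))" using Y_def by blast
  then have Y: "endo scale Y" using X P(2) by (simp add: endo_minus endo_comp)
  \<comment> \<open>The exponent has to be positive because \<open>Y ^^ 0\<close> is the identity;
    hence the separate case \<open>n = 0\<close> below.\<close>
  have pow: "(Y ^^ Suc j) x = (X ^^ Suc j) x - P ((X ^^ Suc j) x)" for j x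
    by (induction j) (simp_all add: Y_def endo_simps[OF X] XP)
  have "trace X = trace Y + trace (\<lambda>x. P (X x))"
    unfolding trace_add[symmetric] Y_def by simp
  also have "trace (\<lambda>x. P (X x)) = trace (\<lambda>x. X (P x))" by (rule trace_comp_commute[OF P(2) X])
  also have "\<dots> = 0" by (simp add: XP trace_0)
  finally have tr: "trace X = trace Y" by simp
  show ?case
  proof (cases n)
    case 0
    with Suc.prems(2) have "X = (\<lambda>x. 0)" by auto
    then show ?thesis using trace_0 by simp
  next
    case j: (Suc j)
    have "(Y ^^ n) x = 0" for x
    proof -
      have "X ((X ^^ n) x) = 0" using Suc.prems(2)[of x] by simp
      then show ?thesis using P(3) pow[of j x] j by simp
    qed
    then show ?thesis using Suc.IH[OF Y] tr by simp
  qed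
qed

end


section \<open>The Killing form\<close>

context lie_algebra
begin

lemmas bracket_left_simps = endo_simps[OF bracket_linear_left]
lemmas bracket_right_simps = endo_simps[OF bracket_linear_right]
lemmas bracket_simps = bracket_left_simps bracket_right_simps

lemma bracket_swap: "bracket x y = - bracket y x"
proof -
  have "bracket x y + bracket y x = bracket (x + y) (x + y)"
    by (simp add: bracket_simps bracket_self[of x] bracket_self[of y])
  then show ?thesis by (simp only: bracket_self eq_neg_iff_add_eq_0)
qed

lemma bracket_bracket: "bracket (bracket x y) z = bracket x (bracket y z) - bracket y (bracket x z)"
  using jacobi[of x y z] bracket_swap[of z "bracket x y"] bracket_swap[of z x]
  by (simp add: bracket_simps add_eq_0_iff2)

lemma endo_bracket_comp: "endo scale f \<Longrightarrow> endo scale (\<lambda>x. bracket y (f x))"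
  by (rule endo_comp[OF bracket_linear_right])

lemma killing_add_left: "killing (x + y) z = killing x z + killing y z"
  and killing_add_right: "killing z (x + y) = killing z x + killing z y"
  and killing_scale_left: "killing (scale c x) z = c * killing x z"
  and killing_scale_right: "killing z (scale c x) = c * killing z x"
  by (simp_all add: killing_def bracket_simps trace_add trace_scale)

lemma killing_0_left: "killing 0 z = 0" and killing_0_right: "killing z 0 = 0"
  using killing_scale_left[of 0] killing_scale_right[of _ 0] by simp_all

lemma killing_neg_left: "killing (- x) z = - killing x z"
  and killing_neg_right: "killing z (- x) = - killing z x"
  using killing_scale_left[of "-1" x z] killing_scale_right[of z "-1" x] by simp_all

lemmas killing_simps = killing_add_left killing_add_right killing_scale_left killing_scale_right
  killing_0_left killing_0_right killing_neg_left killing_neg_right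

lemma killing_commute: "killing x y = killing y x"
  unfolding killing_def by (rule trace_comp_commute[OF bracket_linear_right bracket_linear_right])

lemma killing_bracket: "killing (bracket x y) z = killing x (bracket y z)"
proof -
  have "trace (\<lambda>w. bracket y (bracket x (bracket z w))) = trace (\<lambda>w. bracket x (bracket z (bracket y w)))"
    by (rule trace_comp_commute[of "bracket y" "\<lambda>w. bracket x (bracket z w)"])
       (intro endo_bracket_comp bracket_linear_right)+
  then show ?thesis
    by (simp add: killing_def bracket_bracket bracket_simps trace_diff)
qed

lemma subspace_perp: "subspace (perp U)"
  by (auto simp: perp_def subspace_def killing_simps)

lemma nondegenerate_representation:
  assumes semisimple
    and \<phi>: "\<And>x y. \<phi> (x + y) = \<phi> x + \<phi> y" "\<And>c x. \<phi> (scale c x) = c * \<phi> x"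
  shows "\<exists>h. \<forall>z. killing h z = \<phi> z"
proof -
  \<comment> \<open>The functional \<open>killing x\<close> is recorded as the vector whose
    coordinates are its values on \<open>Basis\<close>. Injectivity and surjectivity can then be
    compared inside one space.\<close>
  define \<Phi> where "\<Phi> x = (\<Sum>b\<in>Basis. scale (killing x b) b)" for x
  have \<Phi>: "endo scale \<Phi>"
    by (simp add: endo_iff \<Phi>_def killing_simps scale_left_distrib sum.distrib scale_sum_right)
  have rep: "representation Basis (\<Sum>b\<in>Basis. scale (f b) b) b = f b" if "b \<in> Basis" for f b
    using that by (simp add: representation_sum representation_scale independent_Basis span_Basis
        representation_basis finite_Basis if_distrib cong: if_cong)
  have ext: "(\<forall>z. \<psi> z = \<chi> z)" if "\<And>b. b \<in> Basis \<Longrightarrow> \<psi> b = \<chi> b"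
    and "\<And>x y. \<psi> (x + y) = \<psi> x + \<psi> y" "\<And>c x. \<psi> (scale c x) = c * \<psi> x"
    and "\<And>x y. \<chi> (x + y) = \<chi> x + \<chi> y" "\<And>c x. \<chi> (scale c x) = c * \<chi> x"
    for \<psi> \<chi> :: "'v \<Rightarrow> 'f"
  proof
    fix z
    have "z \<in> span Basis" using span_Basis by simp
    then show "\<psi> z = \<chi> z"
    proof (induction rule: span_induct_alt)
      case base
      show ?case using that(3)[of 0 0] that(5)[of 0 0] by simp
    qed (simp add: that)
  qed
  have "range \<Phi> = UNIV"
  proof (rule endo_surj_on_subspace[OF \<Phi> subspace_UNIV])
    fix x assume "\<Phi> x = 0"
    then have "killing x b = 0" if "b \<in> Basis" for b
      using rep[OF that, of "killing x"] by (simp add: \<Phi>_def representation_zero)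
    then have "\<forall>z. killing x z = 0" by (intro ext) (simp_all add: killing_simps)
    then show "x = 0" using assms(1) by (simp add: semisimple_def)
  qed simp
  then obtain h where h: "\<Phi> h = (\<Sum>b\<in>Basis. scale (\<phi> b) b)" by (metis rangeE UNIV_I)
  have "killing h b = \<phi> b" if "b \<in> Basis" for b
    using rep[OF that, of "killing h"] rep[OF that, of \<phi>] h by (simp add: \<Phi>_def)
  then have "\<forall>z. killing h z = \<phi> z" by (intro ext) (simp_all add: killing_simps \<phi>)
  then show ?thesis by blast
qed

text \<open>As \<open>N\<close> and \<open>M\<close> commute, \<open>(N o M) ^^ n\<close> is
  \<open>(M ^^ n) o (N ^^ n)\<close>, so \<open>N o M\<close> is nilpotent.\<close>

lemma trace_comp_nilpotent:
  assumes N: "endo scale N" and M: "endo scale M" and comm: "\<And>x. N (M x) = M (N x)"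
    and nilp: "\<And>x. (N ^^ n) x = 0"
  shows "trace (\<lambda>x. N (M x)) = 0"
proof (rule trace_nilpotent[where n = n])
  show "endo scale (\<lambda>x. N (M x))" by (rule endo_comp[OF N M])
  have *: "(N ^^ k) (M x) = M ((N ^^ k) x)" for k x by (induction k) (simp_all add: comm)
  have "((\<lambda>x. N (M x)) ^^ k) x = (M ^^ k) ((N ^^ k) x)" for k x
  proof (induction k arbitrary: x)
    case (Suc k)
    have "((\<lambda>x. N (M x)) ^^ Suc k) x = (M ^^ k) ((N ^^ k) (N (M x)))"
      by (simp only: funpow_Suc_right o_apply Suc.IH)
    also have "\<dots> = (M ^^ k) (M ((N ^^ k) (N x)))" by (simp add: comm *)
    also have "\<dots> = (M ^^ Suc k) ((N ^^ Suc k) x)" by (simp add: funpow_swap1)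
    finally show ?case .
  qed simp
  then show "((\<lambda>x. N (M x)) ^^ n) x = 0" for x
    using nilp endo_0[OF endo_funpow[OF M]] by metis
qed

text \<open>If the conclusion failed for \<open>t = 0, 1, 2, \<dots>\<close>, the kernels would yield infinitely many
  independent vectors, by the argument for eigenvectors to distinct eigenvalues.\<close>

lemma ex_pencil_kernel:
  assumes S: "endo scale S" and T: "endo scale T" and comm: "\<And>x. S (T x) = T (S x)"
    and sq: "\<And>x. T (T x) = 0 \<Longrightarrow> T x = 0"
  shows "\<exists>t. \<forall>x. S x + scale t (T x) = 0 \<longrightarrow> T x = 0"
proof (rule ccontr)
  assume "\<not> ?thesis"
  then have "\<exists>x. S x + scale (of_nat i) (T x) = 0 \<and> T x \<noteq> 0" for i :: nat by blast
  then obtain x where x: "\<And>i. S (x i) + scale (of_nat i) (T (x i)) = 0" "\<And>i. T (x i) \<noteq> 0"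
    by metis
  have indep: "\<forall>i\<in>I. c i = 0" if "finite I" "(\<Sum>i\<in>I. scale (c i) (T (x i))) = 0" for I c
    using that
  proof (induction I arbitrary: c rule: finite_induct)
    case (insert n I)
    \<comment> \<open>Applying \<open>S + n T\<close> to the linear relation removes its
      \<open>n\<close>-th term and turns the rest into \<open>T (T y)\<close>. Then
      \<open>sq\<close> gives \<open>T y = 0\<close>, a relation over \<open>I\<close>
      alone.\<close>
    define y where "y = (\<Sum>i\<in>I. scale (c i * (of_nat n - of_nat i)) (x i))"
    have eig: "S (T (x i)) = - scale (of_nat i) (T (T (x i)))" for i
      using arg_cong[OF x(1)[of i], of T] by (simp add: comm endo_simps[OF T] add_eq_0_iff2)
    have "S (\<Sum>i\<in>insert n I. scale (c i) (T (x i)))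
        + scale (of_nat n) (T (\<Sum>i\<in>insert n I. scale (c i) (T (x i))))
        = (\<Sum>i\<in>insert n I. scale (c i * (of_nat n - of_nat i)) (T (T (x i))))"
      by (simp add: endo_sum[OF S] endo_sum[OF T] endo_simps[OF S] endo_simps[OF T] eig scale_sum_right
          algebra_simps flip: sum.distrib del: sum.insert)
    also have "\<dots> = T (T y)"
      using insert.hyps by (simp add: y_def endo_sum[OF T] endo_simps[OF T])
    finally have "T (T y) = 0"
      unfolding insert.prems by (simp add: endo_0[OF S] endo_0[OF T])
    then have "(\<Sum>i\<in>I. scale (c i * (of_nat n - of_nat i)) (T (x i))) = 0"
      using sq[of y] by (simp add: y_def endo_sum[OF T] endo_simps[OF T])
    from insert.IH[OF this] have I: "\<forall>i\<in>I. c i = 0" using insert.hyps by auto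
    then have "(\<Sum>i\<in>I. scale (c i) (T (x i))) = 0" by (intro sum.neutral) simp
    then have "scale (c n) (T (x n)) = 0" using insert.prems insert.hyps by simp
    then show ?case using I x(2) by simp
  qed simp
  show False
    using ex_linear_dependence[of "\<lambda>i. T (x i)"] indep[of "{..dimension}"] by fastforce
qed

end


section \<open>Cartan subspaces of symmetric decompositions\<close>

locale cartan_subspace = lie_algebra scale Basis bracket
  for scale :: "'f::field_char_0 \<Rightarrow> 'v::ab_group_add \<Rightarrow> 'v" and Basis :: "'v set"
    and bracket :: "'v \<Rightarrow> 'v \<Rightarrow> 'v" +
  fixes \<gg>0 \<gg>1 \<aa> :: "'v set"
  assumes semisimple: semisimple
    and symmetric: "symmetric_decomposition \<gg>0 \<gg>1"
    and maximal: "maximal_abelian \<gg>1 \<aa>"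
    and splitting: "direct_sum \<aa> (orth_part \<gg>1 \<aa>) \<gg>1"
begin

abbreviation "\<mm> \<equiv> orth_part \<gg>1 \<aa>"
abbreviation "\<cc> \<equiv> centralizer \<gg>0 \<aa>"
abbreviation "\<bb> \<equiv> cartan_b \<gg>0 \<aa>"

lemma subspace_g0: "subspace \<gg>0" and subspace_g1: "subspace \<gg>1"
  and bracket_00: "x \<in> \<gg>0 \<Longrightarrow> y \<in> \<gg>0 \<Longrightarrow> bracket x y \<in> \<gg>0"
  and bracket_01: "x \<in> \<gg>0 \<Longrightarrow> y \<in> \<gg>1 \<Longrightarrow> bracket x y \<in> \<gg>1"
  and bracket_11: "x \<in> \<gg>1 \<Longrightarrow> y \<in> \<gg>1 \<Longrightarrow> bracket x y \<in> \<gg>0"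
  and g0_g1: "x \<in> \<gg>0 \<Longrightarrow> x \<in> \<gg>1 \<Longrightarrow> x = 0"
  using symmetric by (auto simp: symmetric_decomposition_def direct_sum_def)

lemma bracket_10: "x \<in> \<gg>1 \<Longrightarrow> y \<in> \<gg>0 \<Longrightarrow> bracket x y \<in> \<gg>1"
  by (metis bracket_01 bracket_swap subspace_g1 subspace_neg)

lemma g0_g1_decomposition: obtains x0 x1 where "x0 \<in> \<gg>0" "x1 \<in> \<gg>1" "x = x0 + x1"
proof -
  have "x \<in> \<gg>0 + \<gg>1" using symmetric by (simp add: symmetric_decomposition_def direct_sum_def)
  then show thesis using that by (auto elim: set_plus_elim)
qed

lemma subspace_a: "subspace \<aa>" and a_g1: "x \<in> \<aa> \<Longrightarrow> x \<in> \<gg>1"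
  and abelian: "x \<in> \<aa> \<Longrightarrow> y \<in> \<aa> \<Longrightarrow> bracket x y = 0"
  using maximal by (auto simp: maximal_abelian_def abelian_subspace_def)

lemma in_m_iff: "x \<in> \<mm> \<longleftrightarrow> x \<in> \<gg>1 \<and> (\<forall>y\<in>\<aa>. killing x y = 0)"
  by (auto simp: orth_part_def perp_def)

lemma in_c_iff: "x \<in> \<cc> \<longleftrightarrow> x \<in> \<gg>0 \<and> (\<forall>y\<in>\<aa>. bracket x y = 0)"
  by (auto simp: centralizer_def)

lemma in_b_iff: "x \<in> \<bb> \<longleftrightarrow> x \<in> \<gg>0 \<and> (\<forall>y\<in>\<cc>. killing x y = 0)"
  by (auto simp: cartan_b_def perp_def)

lemma subspace_m: "subspace \<mm>" and subspace_b: "subspace \<bb>"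
  unfolding orth_part_def cartan_b_def
  by (intro subspace_inter subspace_perp subspace_g0 subspace_g1)+

lemma a_m: "x \<in> \<aa> \<Longrightarrow> x \<in> \<mm> \<Longrightarrow> x = 0"
  using splitting by (auto simp: direct_sum_def)

lemma a_m_decomposition:
  assumes "x \<in> \<gg>1" obtains u v where "u \<in> \<aa>" "v \<in> \<mm>" "x = u + v"
proof -
  have "x \<in> \<aa> + \<mm>" using splitting assms by (simp add: direct_sum_def)
  then show thesis using that by (auto elim: set_plus_elim)
qed

text \<open>Adjoining \<open>x\<close> to \<open>\<aa>\<close> keeps the subspace abelian, so
  maximality applies.\<close>

lemma a_self_centralizing:
  assumes "x \<in> \<gg>1" "\<And>y. y \<in> \<aa> \<Longrightarrow> bracket y x = 0"
  shows "x \<in> \<aa>"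
proof -
  have x: "bracket x y = 0" if "y \<in> \<aa>" for y
    using assms(2)[OF that] bracket_swap[of x y] by simp
  have decomp: "\<exists>k. \<exists>a\<in>\<aa>. y = a + scale k x" if "y \<in> span (insert x \<aa>)" for y
    using that span_eq_iff[THEN iffD2, OF subspace_a]
    by (auto simp: span_insert intro: diff_add_cancel[symmetric])
  have "abelian_subspace \<gg>1 (span (insert x \<aa>))"
    unfolding abelian_subspace_def
  proof (intro conjI ballI)
    show "span (insert x \<aa>) \<subseteq> \<gg>1"
      by (rule span_minimal) (use assms(1) a_g1 subspace_g1 in auto)
    fix y z assume "y \<in> span (insert x \<aa>)" "z \<in> span (insert x \<aa>)"
    then obtain k a l b where "a \<in> \<aa>" "y = a + scale k x" "b \<in> \<aa>" "z = b + scale l x"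
      using decomp by metis
    then show "bracket y z = 0"
      using assms(2) by (simp add: bracket_simps x bracket_self abelian)
  qed (rule subspace_span)
  then have "span (insert x \<aa>) = \<aa>"
    using maximal span_superset[of "insert x \<aa>"] by (auto simp: maximal_abelian_def)
  then show ?thesis using span_base[of x "insert x \<aa>"] by auto
qed

text \<open>The involution \<open>\<theta>\<close> with eigenspaces \<open>\<gg>\<^sub>0\<close>, \<open>\<gg>\<^sub>1\<close> conjugates \<open>ad x \<circ> ad y\<close> into its negative.\<close>

lemma killing_g0_g1:
  assumes "x \<in> \<gg>0" "y \<in> \<gg>1"
  shows "killing x y = 0"
proof -
  interpret vector_space_pair scale scale by unfold_locales
  obtain p where p: "range p \<subseteq> \<gg>0" "endo scale p" "\<And>x. x \<in> \<gg>0 \<Longrightarrow> p x = x"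
      "\<And>x. x \<in> \<gg>1 \<Longrightarrow> p x = 0"
  proof -
    \<comment> \<open>This is the projection onto \<open>\<gg>0\<close> along \<open>\<gg>1\<close>;
      the choice is unique because the summands meet only in \<open>0\<close>.\<close>
    define p where "p x = (THE u. u \<in> \<gg>0 \<and> x - u \<in> \<gg>1)" for x
    have p: "p (u + v) = u" if "u \<in> \<gg>0" "v \<in> \<gg>1" for u v
      unfolding p_def
    proof (rule the_equality)
      fix w assume w: "w \<in> \<gg>0 \<and> u + v - w \<in> \<gg>1"
      then have "u - w \<in> \<gg>0" using that subspace_g0 subspace_diff by blast
      moreover have "u - w \<in> \<gg>1"
        using subspace_diff[OF subspace_g1, of "u + v - w" v] w that by (simp add: algebra_simps)
      ultimately show "w = u" using g0_g1 by fastforce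
    qed (use that in auto)
    show thesis
    proof
      show "range p \<subseteq> \<gg>0"
        by (rule image_subsetI) (metis g0_g1_decomposition p)
      show "endo scale p"
        unfolding endo_iff
      proof (intro conjI allI)
        fix x y
        obtain x0 x1 y0 y1 where *: "x0 \<in> \<gg>0" "x1 \<in> \<gg>1" "x = x0 + x1" "y0 \<in> \<gg>0" "y1 \<in> \<gg>1" "y = y0 + y1"
          by (metis g0_g1_decomposition)
        have "p (x + y) = p ((x0 + y0) + (x1 + y1))" using * by (simp add: algebra_simps)
        also have "\<dots> = p x + p y"
          using * by (simp add: p subspace_add subspace_g0 subspace_g1)
        finally show "p (x + y) = p x + p y" .
        fix c
        show "p (scale c x) = scale c (p x)"
          using * by (simp add: p scale_right_distrib subspace_scale subspace_g0 subspace_g1)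
      qed
      show "p x = x" if "x \<in> \<gg>0" for x using p[OF that, of 0] by (simp add: subspace_0 subspace_g1)
      show "p x = 0" if "x \<in> \<gg>1" for x using p[of 0 x] that by (simp add: subspace_0 subspace_g0)
    qed
  qed
  define \<theta> where "\<theta> x = p x + p x - x" for x
  have \<theta>: "endo scale \<theta>"
    using p(2) by (simp add: endo_iff \<theta>_def algebra_simps)
  have \<theta>0: "\<theta> z = z" if "z \<in> \<gg>0" for z using that by (simp add: \<theta>_def p)
  have \<theta>1: "\<theta> z = - z" if "z \<in> \<gg>1" for z using that by (simp add: \<theta>_def p)
  let ?F = "\<lambda>z. bracket x (bracket y z)"
  have F: "endo scale ?F" by (rule endo_bracket_comp bracket_linear_right)+
  have \<theta>F: "\<theta> (?F (\<theta> z)) = - ?F z" for z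
  proof -
    obtain z0 z1 where z: "z0 \<in> \<gg>0" "z1 \<in> \<gg>1" "z = z0 + z1" by (rule g0_g1_decomposition)
    have "?F z0 \<in> \<gg>1" "?F z1 \<in> \<gg>0"
      using z assms by (simp_all add: bracket_00 bracket_01 bracket_10 bracket_11)
    then show ?thesis
      using z by (simp add: endo_simps[OF \<theta>] \<theta>0 \<theta>1 bracket_simps)
  qed
  have \<theta>\<theta>: "\<theta> (\<theta> z) = z" for z
  proof -
    obtain z0 z1 where z: "z0 \<in> \<gg>0" "z1 \<in> \<gg>1" "z = z0 + z1" by (rule g0_g1_decomposition)
    then show ?thesis by (simp add: endo_simps[OF \<theta>] \<theta>0 \<theta>1)
  qed
  have "killing x y = trace (\<lambda>z. ?F (\<theta> (\<theta> z)))" by (simp add: killing_def \<theta>\<theta>)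
  also have "\<dots> = trace (\<lambda>z. \<theta> (?F (\<theta> z)))"
    by (rule trace_comp_commute[OF endo_comp[OF F \<theta>] \<theta>])
  also have "\<dots> = - killing x y"
    unfolding \<theta>F killing_def using trace_scale[of "-1" ?F] by simp
  finally have "2 * killing x y = 0" by simp
  then show ?thesis by simp
qed

section \<open>Nondegeneracy on the summands, and the kernel of the square of
  \<open>ad A\<close>\<close>

lemma killing_g1_g0: "x \<in> \<gg>1 \<Longrightarrow> y \<in> \<gg>0 \<Longrightarrow> killing x y = 0"
  using killing_g0_g1 killing_commute by metis

lemma nondegenerate_g0:
  assumes "x \<in> \<gg>0" "\<And>y. y \<in> \<gg>0 \<Longrightarrow> killing x y = 0"
  shows "x = 0"
proof -
  have "killing x z = 0" for z
    by (rule g0_g1_decomposition[of z]) (simp add: assms killing_simps killing_g0_g1)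
  then show ?thesis using semisimple by (simp add: semisimple_def)
qed

lemma nondegenerate_g1:
  assumes "x \<in> \<gg>1" "\<And>y. y \<in> \<gg>1 \<Longrightarrow> killing x y = 0"
  shows "x = 0"
proof -
  have "killing x z = 0" for z
    by (rule g0_g1_decomposition[of z]) (simp add: assms killing_simps killing_g1_g0)
  then show ?thesis using semisimple by (simp add: semisimple_def)
qed

text \<open>For \<open>A\<close> in \<open>\<aa>\<close> and \<open>w\<close> in
  \<open>\<gg>0\<close>, the map \<open>N o ad [A, w]\<close> is the commutator of
  \<open>ad A\<close> with \<open>N o ad w\<close>, hence traceless. So the representing element
  \<open>h1\<close> commutes with \<open>\<aa>\<close> and lies in \<open>\<aa>\<close>. It is also
  orthogonal to \<open>\<aa>\<close>, since each \<open>N o ad A\<close> is nilpotent.\<close>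

lemma trace_nilpotent_ad:
  assumes N: "endo scale N" and nilp: "\<And>x. (N ^^ n) x = 0"
    and comm: "\<And>A x. A \<in> \<aa> \<Longrightarrow> N (bracket A x) = bracket A (N x)"
    and z: "z \<in> \<gg>1"
  shows "trace (\<lambda>x. N (bracket z x)) = 0"
proof -
  define \<phi> where "\<phi> z = trace (\<lambda>x. N (bracket z x))" for z
  have "\<exists>h. \<forall>z. killing h z = \<phi> z"
    by (rule nondegenerate_representation[OF semisimple])
       (simp_all add: \<phi>_def bracket_simps endo_simps[OF N] trace_add trace_scale)
  then obtain h where h: "\<And>z. killing h z = \<phi> z" by blast
  obtain h0 h1 where h01: "h0 \<in> \<gg>0" "h1 \<in> \<gg>1" "h = h0 + h1" by (rule g0_g1_decomposition)
  have h1: "killing h1 z = \<phi> z" if "z \<in> \<gg>1" for z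
    using h[of z] h01 that by (simp add: killing_simps killing_g0_g1)
  have "h1 \<in> \<aa>"
  proof (rule a_self_centralizing[OF h01(2)])
    fix A assume A: "A \<in> \<aa>"
    have "bracket h1 A = 0"
    proof (rule nondegenerate_g0)
      fix w assume w: "w \<in> \<gg>0"
      have "killing (bracket h1 A) w = \<phi> (bracket A w)"
        using h1 A w by (simp add: killing_bracket bracket_10 a_g1)
      also have "\<dots> = trace (\<lambda>x. bracket A (N (bracket w x))) - trace (\<lambda>x. N (bracket w (bracket A x)))"
        by (simp add: \<phi>_def bracket_bracket endo_simps[OF N] comm A trace_diff)
      also have "\<dots> = 0"
        using trace_comp_commute[of "bracket A" "\<lambda>x. N (bracket w x)"]
          endo_comp[OF N bracket_linear_right] bracket_linear_right by simp
      finally show "killing (bracket h1 A) w = 0" .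
    qed (use h01 A in \<open>simp add: bracket_11 a_g1\<close>)
    then show "bracket A h1 = 0" using bracket_swap[of A h1] by simp
  qed
  moreover have "killing h1 A = 0" if "A \<in> \<aa>" for A
    using h1[OF a_g1[OF that]] trace_comp_nilpotent[OF N bracket_linear_right comm[OF that] nilp]
    by (simp add: \<phi>_def)
  ultimately have "h1 = 0" using a_m h01(2) in_m_iff by blast
  then show ?thesis using h1[OF z] by (simp add: killing_simps \<phi>_def)
qed

text \<open>Cyclicity turns the trace of \<open>[N, ad z] o ad w\<close> into that of
  \<open>N o ad [z, w]\<close>, which vanishes by \<open>trace_nilpotent_ad\<close>.\<close>

lemma killing_bracket_eq_0:
  assumes A: "A \<in> \<aa>" and sq: "bracket A (bracket A z) = 0" and zw: "bracket z w \<in> \<gg>1"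
  shows "killing (bracket A z) w = 0"
proof -
  obtain \<nu> n where nilp: "\<And>x. (poly_map scale (bracket A) \<nu> ^^ n) x = 0"
    and deriv: "\<And>x. poly_map scale (bracket A) (pderiv \<nu>) x = x"
    using ex_nilpotent_poly_map[OF bracket_linear_right] by metis
  define N where "N = poly_map scale (bracket A) \<nu>"
  have N: "endo scale N" unfolding N_def by (rule endo_poly_map[OF bracket_linear_right])
  have comm: "N (bracket A' x) = bracket A' (N x)" if "A' \<in> \<aa>" for A' x
    unfolding N_def
    by (rule poly_map_commute[OF bracket_linear_right bracket_linear_right])
       (use bracket_bracket[of A A'] abelian[OF A that] in \<open>simp add: bracket_simps\<close>)
  \<comment> \<open>The commutator of \<open>ad A\<close> with \<open>ad z\<close> is
    \<open>ad [A, z]\<close>, which commutes with \<open>ad A\<close> by \<open>sq\<close>; so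
    \<open>poly_map_commutator\<close> applies.\<close>
  have C: "bracket (bracket A z) x = N (bracket z x) - bracket z (N x)" for x
    unfolding N_def
    by (subst poly_map_commutator[OF bracket_linear_right bracket_linear_right, of "bracket (bracket A z)"])
       (use bracket_bracket[of A "bracket A z"] in \<open>simp_all add: bracket_bracket deriv sq bracket_simps\<close>)
  have "killing (bracket A z) w = trace (\<lambda>x. N (bracket z (bracket w x))) - trace (\<lambda>x. bracket z (N (bracket w x)))"
    by (simp add: killing_def C trace_diff)
  also have "trace (\<lambda>x. bracket z (N (bracket w x))) = trace (\<lambda>x. N (bracket w (bracket z x)))"
    by (rule trace_comp_commute[OF bracket_linear_right endo_comp[OF N bracket_linear_right]])
  also have "trace (\<lambda>x. N (bracket z (bracket w x))) - \<dots> = trace (\<lambda>x. N (bracket (bracket z w) x))"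
    by (simp add: bracket_bracket endo_simps[OF N] trace_diff)
  also have "\<dots> = 0"
    using nilp unfolding N_def[symmetric] by (rule trace_nilpotent_ad[OF N _ comm zw])
  finally show ?thesis .
qed

text \<open>The components of \<open>z\<close> are treated separately, so that
  \<open>[z0, w]\<close> with \<open>w\<close> in \<open>\<gg>1\<close> and \<open>[z1, w]\<close>
  with \<open>w\<close> in \<open>\<gg>0\<close> both land in \<open>\<gg>1\<close>, as
  \<open>killing_bracket_eq_0\<close> requires.\<close>

lemma bracket_bracket_eq_0:
  assumes A: "A \<in> \<aa>" and sq: "bracket A (bracket A z) = 0"
  shows "bracket A z = 0"
proof -
  obtain z0 z1 where z: "z0 \<in> \<gg>0" "z1 \<in> \<gg>1" "z = z0 + z1" by (rule g0_g1_decomposition)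
  have "bracket A (bracket A z0) \<in> \<gg>0" "bracket A (bracket A z1) \<in> \<gg>1"
    using z A by (simp_all add: bracket_10 bracket_11 a_g1)
  moreover have "bracket A (bracket A z0) = - bracket A (bracket A z1)"
    using sq z by (simp add: bracket_simps add_eq_0_iff2)
  ultimately have sq0: "bracket A (bracket A z0) = 0" and sq1: "bracket A (bracket A z1) = 0"
    using g0_g1 subspace_neg[OF subspace_g1] by (metis, metis neg_equal_0_iff_equal subspace_neg subspace_g1)
  have "bracket A z0 = 0"
    by (rule nondegenerate_g1) (use z A bracket_01 killing_bracket_eq_0[OF A sq0] in
      \<open>auto simp: bracket_10 a_g1\<close>)
  moreover have "bracket A z1 = 0"
    by (rule nondegenerate_g0) (use z A bracket_10 killing_bracket_eq_0[OF A sq1] in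
      \<open>auto simp: bracket_11 a_g1\<close>)
  ultimately show ?thesis by (simp add: z bracket_simps)
qed

text \<open>Let \<open>ad A\<close> have a kernel of least dimension. For suitable \<open>t\<close>
  the kernel of \<open>ad (A + t A')\<close> lies in the kernels of both \<open>ad A'\<close> and
  \<open>ad A\<close>. By minimality it equals the latter, which is therefore contained in the
  kernel of \<open>ad A'\<close>.\<close>

lemma ex_regular:
  obtains A where "A \<in> \<aa>" "\<And>x A'. bracket A x = 0 \<Longrightarrow> A' \<in> \<aa> \<Longrightarrow> bracket A' x = 0"
proof -
  let ?K = "\<lambda>A. {x. bracket A x = 0}"
  have K: "subspace (?K A)" for A by (auto simp: subspace_def bracket_simps)
  obtain A where A: "A \<in> \<aa>" and min: "\<And>A'. A' \<in> \<aa> \<Longrightarrow> dim (?K A) \<le> dim (?K A')"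
    using ex_has_least_nat[of "\<lambda>A. A \<in> \<aa>" 0 "\<lambda>A. dim (?K A)"] subspace_0[OF subspace_a] by blast
  show thesis
  proof
    fix x A' assume x: "bracket A x = 0" and A': "A' \<in> \<aa>"
    have comm: "bracket A (bracket A' x) = bracket A' (bracket A x)" for x
      using bracket_bracket[of A A' x] abelian[OF A A'] by (simp add: bracket_simps)
    obtain t where t: "\<And>x. bracket A x + scale t (bracket A' x) = 0 \<Longrightarrow> bracket A' x = 0"
      using ex_pencil_kernel[OF bracket_linear_right bracket_linear_right comm]
        bracket_bracket_eq_0[OF A'] by blast
    have "?K (A + scale t A') = ?K A"
    proof (rule subspace_dim_equal[OF K K])
      show "?K (A + scale t A') \<subseteq> ?K A"
      proof clarify
        fix x assume "bracket (A + scale t A') x = 0"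
        then have "bracket A x + scale t (bracket A' x) = 0" by (simp add: bracket_simps)
        with t[OF this] show "bracket A x = 0" by simp
      qed
      show "dim (?K A) \<le> dim (?K (A + scale t A'))"
        by (rule min) (simp add: A A' subspace_a subspace_add subspace_scale)
    qed
    then have "bracket (A + scale t A') x = 0" using x by blast
    then show "bracket A' x = 0" using t[of x] by (simp add: bracket_simps)
  qed (rule A)
qed

end


section \<open>The Cartan tableau\<close>

lemma (in lie_algebra) ex_flag:
  assumes V: "subspace V" and x: "x \<in> V"
  shows "\<exists>l. flag V l \<and> (\<forall>j\<in>{1..dim V}. x \<in> l j)"
proof -
  \<comment> \<open>The vector \<open>x\<close> may be \<open>0\<close>, which cannot belong to a
    basis but lies in every span.\<close>
  have "independent ({x} - {0})" by (simp add: insert_Diff_if independent_empty)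
  then obtain B where B: "{x} - {0} \<subseteq> B" "B \<subseteq> V" "independent B" "V \<subseteq> span B"
    using maximal_independent_subset_extend[of "{x} - {0}" V] x by auto
  have "finite B" by (rule finiteI_independent[OF B(3)])
  then obtain ys where ys: "set ys = B - {x}" "distinct ys"
    using finite_distinct_list[of "B - {x}"] by auto
  define xs where "xs = (if x = 0 then ys else x # ys)"
  have xs: "set xs = B" "distinct xs"
    using ys B(1) dependent_zero[of B] B(3) by (auto simp: xs_def)
  have x_hd: "x \<in> span (set (take j xs))" if "1 \<le> j" for j
    using that by (cases j) (auto simp: xs_def span_zero intro: span_base)
  have dimV: "dim V = length xs"
    using xs B basis_card_eq_dim[of B V] distinct_card[of xs] by simp
  let ?l = "\<lambda>j. span (set (take j xs))"
  have "dim (?l j) = j" if "j \<le> length xs" for j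
  proof -
    have "independent (set (take j xs))"
      using B(3) by (rule independent_mono) (use xs set_take_subset in metis)
    then have "dim (?l j) = card (set (take j xs))" by (simp add: dim_eq_card_independent)
    then show ?thesis using that xs by (simp add: distinct_card)
  qed
  moreover have "?l j \<subseteq> ?l (Suc j)" for j
    by (intro span_mono set_take_subset_set_take) simp
  moreover have "?l (length xs) = V"
    using B V xs by (simp add: span_minimal subset_antisym)
  ultimately have "flag V ?l" unfolding flag_def dimV by simp
  then show ?thesis using x_hd by (intro exI[of _ ?l]) auto
qed

context lie_algebra
begin

sublocale Hom1: vector_space "fscale scale"
  by (rule vector_space_fscale) unfold_locales

sublocale Hom2: vector_space "fscale (fscale scale)"
  by (rule vector_space_fscale) unfold_locales

lemma linear_neg_ad: "Vector_Spaces.linear scale (fscale scale) (neg_ad V)"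
  unfolding Vector_Spaces.linear_iff
  by (auto simp: vector_space_axioms Hom1.vector_space_axioms neg_ad_def fscale_def fun_eq_iff bracket_simps)

end

section \<open>Injectivity, curvature and torsion\<close>

context cartan_subspace
begin

abbreviation "\<A> \<equiv> neg_ad \<aa> ` \<mm>"

lemma neg_ad_a: "A \<in> \<aa> \<Longrightarrow> neg_ad \<aa> X A = bracket A X"
  using bracket_swap[of A X] by (simp add: neg_ad_def)

lemma neg_ad_not_a: "A \<notin> \<aa> \<Longrightarrow> neg_ad \<aa> X A = 0"
  by (simp add: neg_ad_def)

lemma m_g1: "X \<in> \<mm> \<Longrightarrow> X \<in> \<gg>1" by (simp add: in_m_iff)

text \<open>By invariance the product of \<open>[A, X]\<close> with \<open>Z\<close> is minus that
  of \<open>X\<close> with \<open>[A, Z] = 0\<close>.\<close>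

lemma bracket_a_g1_in_b:
  assumes "A \<in> \<aa>" "X \<in> \<gg>1" shows "bracket A X \<in> \<bb>"
  unfolding in_b_iff
proof (intro conjI ballI)
  fix Z assume "Z \<in> \<cc>"
  then have "bracket A Z = 0" using assms bracket_swap[of A Z] by (simp add: in_c_iff)
  moreover have "killing (bracket A X) Z = - killing X (bracket A Z)"
    using bracket_swap[of A X] by (simp add: killing_simps killing_bracket)
  ultimately show "killing (bracket A X) Z = 0" by (simp add: killing_simps)
qed (use assms in \<open>simp add: bracket_11 a_g1\<close>)

lemma neg_ad_inj: "inj_on (neg_ad \<aa>) \<mm>"
proof (rule inj_onI)
  fix X Y assume X: "X \<in> \<mm>" and Y: "Y \<in> \<mm>" and eq: "neg_ad \<aa> X = neg_ad \<aa> Y"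
  have "bracket A (X - Y) = 0" if "A \<in> \<aa>" for A
    using fun_cong[OF eq, of A] that by (simp add: neg_ad_a bracket_simps)
  moreover have XY: "X - Y \<in> \<mm>" using X Y subspace_m by (rule subspace_diff[rotated])
  ultimately have "X - Y \<in> \<aa>" by (intro a_self_centralizing m_g1)
  then have "X - Y = 0" using XY by (rule a_m)
  then show "X = Y" by simp
qed

text \<open>The \<open>\<aa>\<close>-component of \<open>X\<close> acts trivially on
  \<open>\<aa>\<close>. Thus elements such as \<open>[[A, X], X]\<close> need no projection to
  \<open>\<mm>\<close>.\<close>

lemma neg_ad_g1: "X \<in> \<gg>1 \<Longrightarrow> neg_ad \<aa> X \<in> \<A>"
proof -
  assume "X \<in> \<gg>1"
  then obtain U V where UV: "U \<in> \<aa>" "V \<in> \<mm>" "X = U + V" by (rule a_m_decomposition)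
  then have "neg_ad \<aa> X = neg_ad \<aa> V"
    by (auto simp: neg_ad_def fun_eq_iff bracket_simps abelian)
  then show ?thesis using UV by blast
qed

text \<open>The mixed terms cancel because \<open>ad A1\<close> and \<open>ad A2\<close>
  commute.\<close>

lemma graph_bracket_neg_ad:
  assumes "A1 \<in> \<aa>" "A2 \<in> \<aa>"
  shows "graph_bracket (neg_ad \<aa> X) A1 A2 = bracket (bracket A1 X) (bracket A2 X)"
proof -
  have "bracket A1 (bracket A2 X) = bracket A2 (bracket A1 X)"
    using bracket_bracket[of A1 A2 X] assms by (simp add: abelian bracket_simps)
  moreover have "bracket (bracket A1 X) A2 = - bracket A2 (bracket A1 X)" by (rule bracket_swap)
  ultimately show ?thesis
    using assms by (simp add: graph_bracket_def neg_ad_a bracket_simps abelian)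
qed

text \<open>For \<open>Z \<in> \<cc>\<close> the Killing product of \<open>[[A\<^sub>1, X], [A\<^sub>2, X]]\<close> and \<open>Z\<close> is both symmetric and
  skew-symmetric in \<open>A\<^sub>1\<close>, \<open>A\<^sub>2\<close>.\<close>

lemma bracket_bracket_in_b:
  assumes A: "A1 \<in> \<aa>" "A2 \<in> \<aa>" and X: "X \<in> \<gg>1"
  shows "bracket (bracket A1 X) (bracket A2 X) \<in> \<bb>"
  unfolding in_b_iff
proof (intro conjI ballI)
  fix Z assume Z: "Z \<in> \<cc>"
  define f where "f A1 A2 = killing (bracket (bracket A1 X) (bracket A2 X)) Z" for A1 A2
  have f: "f A1 A2 = killing (bracket A2 (bracket A1 X)) (bracket Z X)" if "A1 \<in> \<aa>" "A2 \<in> \<aa>" for A1 A2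
  proof -
    have "bracket Z A2 = 0" using Z that by (simp add: in_c_iff)
    then have "bracket (bracket A2 X) Z = - bracket A2 (bracket Z X)"
      using bracket_swap[of "bracket A2 X" Z] bracket_bracket[of Z A2 X] by (simp add: bracket_simps)
    moreover have "f A1 A2 = killing (bracket A1 X) (bracket (bracket A2 X) Z)"
      by (simp add: f_def killing_bracket)
    ultimately have "f A1 A2 = - killing (bracket (bracket A1 X) A2) (bracket Z X)"
      by (simp add: killing_bracket killing_simps)
    also have "\<dots> = killing (bracket A2 (bracket A1 X)) (bracket Z X)"
      by (subst bracket_swap) (simp add: killing_simps)
    finally show ?thesis .
  qed
  have "bracket A1 (bracket A2 X) = bracket A2 (bracket A1 X)"
    using bracket_bracket[of A1 A2 X] A by (simp add: abelian bracket_simps)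
  then have "f A1 A2 = f A2 A1" using A by (simp add: f)
  moreover have "f A1 A2 = - f A2 A1"
    unfolding f_def by (subst bracket_swap) (simp add: killing_simps)
  ultimately have "2 * f A1 A2 = 0" by simp
  then show "killing (bracket (bracket A1 X) (bracket A2 X)) Z = 0" by (simp add: f_def)
qed (use assms in \<open>simp add: bracket_00 bracket_11 a_g1\<close>)

lemma a_b: "\<aa> \<inter> \<bb> = {0}"
  using g0_g1 a_g1 subspace_0[OF subspace_a] subspace_0[OF subspace_b] by (auto simp: in_b_iff)

lemma component_b: "x \<in> \<bb> \<Longrightarrow> component \<bb> \<aa> x = x"
  and component_a: "x \<in> \<bb> \<Longrightarrow> component \<aa> \<bb> x = 0"
proof -
  assume x: "x \<in> \<bb>"
  have *: "u = x \<and> v = 0" if "u \<in> \<bb>" "v \<in> \<aa>" "x = u + v" for u v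
  proof -
    have "x - u = v" using that(3) by simp
    then have "v \<in> \<aa> \<inter> \<bb>" using subspace_diff[OF subspace_b x that(1)] that(2) by simp
    then show ?thesis using that(3) a_b by auto
  qed
  show "component \<bb> \<aa> x = x" unfolding component_def
    by (rule the_equality) (use x * subspace_0[OF subspace_a] in \<open>auto intro!: bexI[of _ 0]\<close>)
  show "component \<aa> \<bb> x = 0" unfolding component_def
    by (rule the_equality) (use x * subspace_0[OF subspace_a] in \<open>auto simp: add.commute\<close>)
qed

lemma tableau_curvature:
  assumes "Q \<in> \<A>" "A1 \<in> \<aa>" "A2 \<in> \<aa>"
  shows "curvature \<aa> \<bb> Q A1 A2 = \<aa> + \<bb>"
proof -
  obtain X where X: "X \<in> \<mm>" "Q = neg_ad \<aa> X" using assms(1) by blast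
  let ?g = "graph_bracket Q A1 A2"
  have g: "?g \<in> \<bb>"
    using bracket_bracket_in_b[OF assms(2,3) m_g1[OF X(1)]] X assms by (simp add: graph_bracket_neg_ad)
  have "?g + (u + v) \<in> \<aa> + \<bb>" if "u \<in> \<aa>" "v \<in> \<bb>" for u v
    using set_plus_intro[OF that(1) subspace_add[OF subspace_b g that(2)]] by (simp add: add_ac)
  moreover have "\<exists>w\<in>\<aa> + \<bb>. u + v = ?g + w" if "u \<in> \<aa>" "v \<in> \<bb>" for u v
    using set_plus_intro[OF that(1) subspace_diff[OF subspace_b that(2) g]]
    by (intro bexI[of _ "u + (v - ?g)"]) auto
  ultimately show ?thesis
    unfolding curvature_def elt_set_plus_def by (auto elim!: set_plus_elim)
qed

text \<open>The preimage under \<open>rho\<close> is \<open>A \<mapsto> - ad [[A, X], X]\<close>, by the Jacobi identity.\<close>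

lemma tableau_torsion:
  assumes "Q \<in> \<A>"
  shows "torsion \<aa> \<bb> Q \<in> rho ` Hom_tableau \<aa> \<A>"
proof -
  obtain X where X: "X \<in> \<mm>" "Q = neg_ad \<aa> X" using assms by blast
  define F where "F A = (if A \<in> \<aa> then neg_ad \<aa> (bracket (bracket A X) X) else 0)" for A
  have "F \<in> Hom_tableau \<aa> \<A>"
    unfolding Hom_def
  proof (intro CollectI conjI ballI allI impI)
    fix A assume "A \<in> \<aa>"
    then show "F A \<in> \<A>"
      unfolding F_def using X by (simp add: neg_ad_g1 bracket_01 bracket_11 a_g1 m_g1)
  qed (auto simp: F_def neg_ad_def fscale_def fun_eq_iff bracket_simps subspace_a subspace_add subspace_scale)
  moreover have "torsion \<aa> \<bb> Q = rho F"
  proof (intro ext)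
    fix A1 A2
    show "torsion \<aa> \<bb> Q A1 A2 = rho F A1 A2"
    proof (cases "A1 \<in> \<aa> \<and> A2 \<in> \<aa>")
      case True
      let ?g = "bracket (bracket A1 X) (bracket A2 X)"
      have g: "?g \<in> \<bb>" using True X by (simp add: bracket_bracket_in_b m_g1)
      have comm: "bracket A1 (bracket A2 X) = bracket A2 (bracket A1 X)"
        using bracket_bracket[of A1 A2 X] True by (simp add: abelian bracket_simps)
      \<comment> \<open>The Leibniz rule gives the same first term in both expansions. Their
        difference is twice \<open>?g\<close>, which absorbs the factor \<open>1/2\<close> of
        \<open>rho\<close>.\<close>
      have 1: "bracket A2 (bracket (bracket A1 X) X) = bracket (bracket A2 (bracket A1 X)) X + ?g"
        using bracket_bracket[of A2 "bracket A1 X" X] by simp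
      have 2: "bracket A1 (bracket (bracket A2 X) X) = bracket (bracket A2 (bracket A1 X)) X - ?g"
        using bracket_bracket[of A1 "bracket A2 X" X] bracket_swap[of "bracket A2 X" "bracket A1 X"]
        by (simp add: comm)
      have "rho F A1 A2 = scale (1/2) (?g + ?g)"
        using True by (simp add: rho_def F_def neg_ad_a 1 2)
      also have "\<dots> = ?g" by (simp add: scale_right_distrib flip: scale_left_distrib)
      finally show ?thesis
        using True X g by (simp add: torsion_def graph_bracket_neg_ad component_a component_b neg_ad_a
            subspace_0 subspace_a bracket_simps)
    next
      case False
      then show ?thesis by (auto simp: torsion_def rho_def F_def neg_ad_not_a)
    qed
  qed
  ultimately show ?thesis by blast
qed

end

section \<open>Isomorphisms between \<open>\<mm>\<close> and \<open>\<bb>\<close> given by a regular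
  element\<close>

locale regular_element = cartan_subspace +
  fixes A0
  assumes A0: "A0 \<in> \<aa>"
    and regular: "bracket A0 x = 0 \<Longrightarrow> A \<in> \<aa> \<Longrightarrow> bracket A x = 0"
begin

lemma ad_inj_m:
  assumes "X \<in> \<mm>" "bracket A0 X = 0" shows "X = 0"
proof (rule a_m)
  show "X \<in> \<aa>" using m_g1[OF assms(1)] regular[OF assms(2)] by (rule a_self_centralizing)
qed fact

lemma in_c_of_regular:
  assumes "z \<in> \<gg>0" "bracket A0 z = 0" shows "z \<in> \<cc>"
  unfolding in_c_iff
proof (intro conjI ballI)
  fix A assume "A \<in> \<aa>"
  then have "bracket A z = 0" by (rule regular[OF assms(2)])
  then show "bracket z A = 0" using bracket_swap[of z A] by simp
qed fact

text \<open>As \<open>ad A0\<close> and its square have the same kernel, \<open>ad A0\<close> is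
  bijective on its range, so kernel and range span the Lie algebra. This is the
  \<open>\<gg>0\<close> part of that splitting; regularity puts the kernel part into
  \<open>\<cc>\<close>.\<close>

lemma g0_fitting:
  assumes y: "y \<in> \<gg>0"
  shows "\<exists>z\<in>\<cc>. \<exists>x\<in>\<gg>1. y = z + bracket A0 x"
proof -
  interpret vector_space_pair scale scale by unfold_locales
  have "bracket A0 ` range (bracket A0) = range (bracket A0)"
    by (rule endo_surj_on_subspace[OF bracket_linear_right])
       (auto intro: linear_subspace_image[OF bracket_linear_right] bracket_bracket_eq_0[OF A0])
  then obtain v where v: "bracket A0 y = bracket A0 (bracket A0 v)" by (metis imageE rangeI)
  obtain v0 v1 where v01: "v0 \<in> \<gg>0" "v1 \<in> \<gg>1" "v = v0 + v1" by (rule g0_g1_decomposition)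
  \<comment> \<open>These vectors turn out to be equal but lie in different summands, so both
    vanish, and the \<open>\<gg>1\<close> part of \<open>v\<close> suffices.\<close>
  have a: "bracket A0 (y - bracket A0 v1) \<in> \<gg>1" "bracket A0 (bracket A0 v0) \<in> \<gg>0"
    using y v01 A0 by (simp_all add: a_g1 bracket_10 bracket_11 subspace_diff subspace_g0)
  moreover have "bracket A0 (y - bracket A0 v1) = bracket A0 (bracket A0 v0)"
    using v v01 by (simp add: bracket_simps)
  ultimately have "bracket A0 (y - bracket A0 v1) = 0" using g0_g1 by metis
  moreover have "y - bracket A0 v1 \<in> \<gg>0"
    using y v01 A0 by (simp add: subspace_diff subspace_g0 a_g1 bracket_11)
  ultimately have "y - bracket A0 v1 \<in> \<cc>" by (intro in_c_of_regular)
  then show ?thesis using v01 by (intro bexI[of _ "y - bracket A0 v1"] bexI[of _ v1]) simp_all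
qed

text \<open>Such a \<open>y\<close> is orthogonal to \<open>\<cc>\<close>, being in
  \<open>\<bb>\<close>, and to \<open>[A0, \<gg>1]\<close>, being in \<open>\<cc>\<close>; these two
  span \<open>\<gg>0\<close>.\<close>

lemma c_b: assumes "y \<in> \<cc>" "y \<in> \<bb>" shows "y = 0"
proof (rule nondegenerate_g0)
  fix w assume "w \<in> \<gg>0"
  then obtain z x where zx: "z \<in> \<cc>" "x \<in> \<gg>1" "w = z + bracket A0 x" using g0_fitting by blast
  have "killing y (bracket A0 x) = killing (bracket y A0) x" by (simp add: killing_bracket)
  also have "\<dots> = 0" using assms A0 by (simp add: in_c_iff killing_simps)
  finally show "killing y w = 0" using assms zx by (simp add: in_b_iff killing_simps)
qed (use assms in \<open>simp add: in_b_iff\<close>)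

lemma ad_inj_b:
  assumes "y \<in> \<bb>" "bracket A0 y = 0" shows "y = 0"
  using in_c_of_regular[OF _ assms(2)] assms(1) c_b[of y] by (simp add: in_b_iff)

text \<open>In the decomposition of \<open>y\<close> from \<open>g0_fitting\<close> the
  \<open>\<cc>\<close>-part also lies in \<open>\<bb>\<close>, hence is zero.\<close>

lemma ad_surj_b:
  assumes y: "y \<in> \<bb>" shows "\<exists>x\<in>\<mm>. bracket A0 x = y"
proof -
  obtain z x where zx: "z \<in> \<cc>" "x \<in> \<gg>1" "y = z + bracket A0 x"
    using g0_fitting[of y] y by (auto simp: in_b_iff)
  obtain u v where uv: "u \<in> \<aa>" "v \<in> \<mm>" "x = u + v" using zx(2) by (rule a_m_decomposition)
  then have x: "bracket A0 x = bracket A0 v" by (simp add: bracket_simps abelian A0)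
  have "z = y - bracket A0 v" using zx x by simp
  then have "z \<in> \<bb>" using y uv by (simp add: subspace_diff subspace_b bracket_a_g1_in_b A0 m_g1)
  then have "z = 0" using zx(1) c_b by blast
  then show ?thesis using zx x uv by auto
qed

section \<open>Characters, prolongation and involutivity\<close>

lemma dim_tableau: "dim1 \<A> = dim \<mm>"
proof -
  interpret finite_dimensional_vector_space_pair_1 scale Basis "fscale scale" by unfold_locales
  show ?thesis
    by (rule dim_image_eq[OF linear_neg_ad]) (simp add: span_eq_iff[THEN iffD2, OF subspace_m] neg_ad_inj)
qed

text \<open>An element of the tableau is determined by its value at \<open>A0\<close>, because
  \<open>ad A0\<close> is injective on \<open>\<mm>\<close>.\<close>

lemma vanishing_tableau:
  assumes "A0 \<in> l j" shows "dim1 (vanishing \<A> l j) = 0"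
proof -
  have "Q = 0" if "Q \<in> vanishing \<A> l j" for Q
  proof -
    obtain X where X: "X \<in> \<mm>" "Q = neg_ad \<aa> X" using \<open>Q \<in> _\<close> by (auto simp: vanishing_def)
    have "Q A0 = 0" using that assms by (simp add: vanishing_def)
    then have "X = 0" using X ad_inj_m A0 by (simp add: neg_ad_a)
    then show ?thesis using X by (auto simp: neg_ad_def bracket_simps fun_eq_iff)
  qed
  then have "vanishing \<A> l j \<subseteq> {0}" by blast
  then have "Hom1.span {} = Hom1.span (vanishing \<A> l j)"
    using Hom1.span_mono[of "vanishing \<A> l j" "{0}"] Hom1.span_mono[of "{}" "vanishing \<A> l j"]
    by (auto simp: Hom1.span_insert_0)
  from Hom1.dim_eq_card[OF this Hom1.independent_empty] show ?thesis by simp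
qed

text \<open>An element \<open>F\<close> of the prolongation is determined by \<open>F A\<^sub>0 = - ad X\<close>, since
  \<open>[A\<^sub>0, L A] = [A, X]\<close> if \<open>F A = - ad (L A)\<close>.\<close>

lemma dim_prolongation: "dim2 (prolongation \<aa> \<A>) = dim \<mm>"
proof -
  interpret P1: vector_space_pair scale scale by unfold_locales
  interpret P2: finite_dimensional_vector_space_pair_1 scale Basis "fscale (fscale scale)"
    by unfold_locales
  have "inj_on (bracket A0) \<mm>"
  proof (rule inj_onI)
    fix X Y assume XY: "X \<in> \<mm>" "Y \<in> \<mm>" "bracket A0 X = bracket A0 Y"
    then have "X - Y = 0" using ad_inj_m[of "X - Y"] by (simp add: bracket_simps subspace_diff subspace_m)
    then show "X = Y" by simp
  qed
  \<comment> \<open>\<open>G\<close> inverts \<open>ad A0\<close> on the image of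
    \<open>\<mm>\<close>, which by \<open>ad_surj_b\<close> contains \<open>\<bb>\<close> and hence
    every \<open>[A, X]\<close> with \<open>A\<close> in \<open>\<aa>\<close> and \<open>X\<close>
    in \<open>\<mm>\<close>.\<close>
  then obtain G where G: "endo scale G" "\<And>X. X \<in> \<mm> \<Longrightarrow> G (bracket A0 X) = X"
    using P1.linear_exists_left_inverse_on[OF bracket_linear_right subspace_m] by blast
  have G_m: "G (bracket A X) \<in> \<mm>" "bracket A0 (G (bracket A X)) = bracket A X"
    if A: "A \<in> \<aa>" and X: "X \<in> \<mm>" for A X
  proof -
    obtain Y where "Y \<in> \<mm>" "bracket A X = bracket A0 Y"
      using ad_surj_b[OF bracket_a_g1_in_b[OF A m_g1[OF X]]] by metis
    then show "G (bracket A X) \<in> \<mm>" "bracket A0 (G (bracket A X)) = bracket A X"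
      by (simp_all add: G(2))
  qed
  define \<Phi> where "\<Phi> X A = (if A \<in> \<aa> then neg_ad \<aa> (G (bracket A X)) else 0)" for X A
  have lin: "Vector_Spaces.linear scale (fscale (fscale scale)) \<Phi>"
    unfolding Vector_Spaces.linear_iff
    by (auto simp: vector_space_axioms Hom2.vector_space_axioms \<Phi>_def neg_ad_def fscale_def fun_eq_iff
        bracket_simps endo_simps[OF G(1)])
  have \<Phi>A0: "\<Phi> X A0 = neg_ad \<aa> X" if "X \<in> \<mm>" for X
    using that by (simp add: \<Phi>_def A0 G(2))
  have "inj_on \<Phi> \<mm>"
    by (rule inj_onI) (metis \<Phi>A0 inj_onD[OF neg_ad_inj])
  moreover have "\<Phi> ` \<mm> = prolongation \<aa> \<A>"
  proof (intro subset_antisym subsetI)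
    fix F assume "F \<in> \<Phi> ` \<mm>"
    then obtain X where X: "X \<in> \<mm>" "F = \<Phi> X" by blast
    have "F \<in> Hom_tableau \<aa> \<A>"
      unfolding Hom_def
    proof (intro CollectI conjI ballI allI impI)
      fix A assume "A \<in> \<aa>"
      then show "F A \<in> \<A>" using X G_m(1) by (simp add: \<Phi>_def)
    qed (auto simp: X \<Phi>_def neg_ad_def fscale_def fun_eq_iff bracket_simps endo_simps[OF G(1)]
        subspace_a subspace_add subspace_scale)
    moreover have "rho F A1 A2 = 0" for A1 A2
    proof (cases "A1 \<in> \<aa> \<and> A2 \<in> \<aa>")
      case True
      \<comment> \<open>\<open>?D\<close> measures the asymmetry of \<open>\<Phi> X\<close>. As
        \<open>ad A0\<close> commutes with \<open>ad A1\<close> and \<open>ad A2\<close> and undoes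
        \<open>G\<close>, it sends \<open>?D\<close> to
        \<open>[A2, [A1, X]] - [A1, [A2, X]] = 0\<close>.\<close>
      let ?D = "bracket A2 (G (bracket A1 X)) - bracket A1 (G (bracket A2 X))"
      have comm: "bracket A (bracket A' x) = bracket A' (bracket A x)" if "A \<in> \<aa>" "A' \<in> \<aa>" for A A' x
        using bracket_bracket[of A A' x] that by (simp add: abelian bracket_simps)
      have "?D \<in> \<bb>"
        using True X by (simp add: subspace_diff subspace_b bracket_a_g1_in_b m_g1 G_m)
      moreover have "bracket A0 ?D = 0"
        using True X by (simp add: bracket_simps comm[OF A0] G_m comm[of A1 A2])
      ultimately have "?D = 0" by (rule ad_inj_b)
      then show ?thesis using True by (simp add: rho_def X \<Phi>_def neg_ad_a)
    next
      case False
      then show ?thesis by (auto simp: rho_def X \<Phi>_def neg_ad_not_a)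
    qed
    ultimately show "F \<in> prolongation \<aa> \<A>" by (simp add: prolongation_def fun_eq_iff)
  next
    fix F assume "F \<in> prolongation \<aa> \<A>"
    then have F: "\<And>A. A \<in> \<aa> \<Longrightarrow> F A \<in> \<A>" "\<And>A. A \<notin> \<aa> \<Longrightarrow> F A = 0" and rho: "rho F = 0"
      by (auto simp: prolongation_def Hom_def)
    obtain X where X: "X \<in> \<mm>" "F A0 = neg_ad \<aa> X" using F(1)[OF A0] by blast
    have "F A = \<Phi> X A" for A
    proof (cases "A \<in> \<aa>")
      case True
      obtain Y where Y: "Y \<in> \<mm>" "F A = neg_ad \<aa> Y" using F(1)[OF True] by blast
      have "rho F A A0 = 0" using rho by simp
      then have "bracket A0 Y = bracket A X" using X Y True by (simp add: rho_def neg_ad_a A0)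
      then have "Y = G (bracket A X)" using G(2)[OF Y(1)] by simp
      then show ?thesis using Y True by (simp add: \<Phi>_def)
    qed (simp add: F(2) \<Phi>_def)
    then show "F \<in> \<Phi> ` \<mm>" using X by blast
  qed
  ultimately show ?thesis
    using P2.dim_image_eq[OF lin, of \<mm>] by (simp add: span_eq_iff[THEN iffD2, OF subspace_m])
qed

lemma tableau_involutive: "involutive \<aa> \<A>"
proof -
  obtain l where l: "flag \<aa> l" "\<And>j. j \<in> {1..dim \<aa>} \<Longrightarrow> A0 \<in> l j"
    using ex_flag[OF subspace_a A0] by blast
  define s :: "nat \<Rightarrow> nat" where "s j = (if j = 1 then dim \<mm> else 0)" for j
  have van: "dim1 (vanishing \<A> l j) = 0" if "j \<in> {1..dim \<aa>}" for j
    using l(2)[OF that] by (rule vanishing_tableau)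
  \<comment> \<open>The flag \<open>l\<close> is generic because no dimension is smaller than
    \<open>0\<close>.\<close>
  have "characters \<aa> \<A> s"
    unfolding characters_def generic_flag_def
    using l(1) van by (intro exI[of _ l]) (simp add: s_def dim_tableau)
  moreover have "dim \<mm> = (\<Sum>j=1..dim \<aa>. j * s j)"
  proof (cases "dim \<aa>")
    case 0
    \<comment> \<open>The sum is empty here, so \<open>\<mm>\<close> has to vanish; it does, because
      \<open>ad A0 = 0\<close> is injective on it.\<close>
    then have "A0 = 0" using A0 by auto
    then have "\<mm> \<subseteq> {0}" using ad_inj_m by (auto simp: bracket_simps)
    then have "dim \<mm> = 0" by simp
    then show ?thesis using 0 by simp
  next
    case (Suc n)
    then show ?thesis by (simp only:) (simp add: s_def if_distrib cong: if_cong)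
  qed
  ultimately show ?thesis unfolding involutive_def dim_prolongation by blast
qed

end

lemma (in cartan_subspace) tableau_over_cartan: "tableau_over \<aa> \<bb> \<A>"
  unfolding tableau_over_def
proof (intro conjI ballI)
  interpret vector_space_pair scale "fscale scale" by unfold_locales
  show "\<A> \<subseteq> Hom scale scale \<aa> \<bb>"
    by (auto simp: Hom_def neg_ad_a neg_ad_not_a bracket_a_g1_in_b m_g1 bracket_simps
        subspace_add subspace_scale subspace_a)
  show "module.subspace (fscale scale) \<A>"
    by (rule linear_subspace_image[OF linear_neg_ad subspace_m])
  obtain A0 where A0: "A0 \<in> \<aa>" "\<And>x A. bracket A0 x = 0 \<Longrightarrow> A \<in> \<aa> \<Longrightarrow> bracket A x = 0"
    using ex_regular by blast
  interpret regular_element scale Basis bracket \<gg>0 \<gg>1 \<aa> A0 by unfold_locales (fact A0)+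
  show "involutive \<aa> \<A>" by (rule tableau_involutive)
qed (simp_all add: subspace_a subspace_b a_b tableau_curvature tableau_torsion)

theorem proposition2p2:
  fixes scale :: "'f::field_char_0 \<Rightarrow> 'v::ab_group_add \<Rightarrow> 'v"
    and Basis :: "'v set"
    and bracket :: "'v \<Rightarrow> 'v \<Rightarrow> 'v"
    and \<gg>0 \<gg>1 \<aa> \<mm> \<bb> :: "'v set"
    and k :: nat
  assumes "lie_algebra scale Basis bracket"
    and "lie_algebra.semisimple scale Basis bracket"
    and "lie_algebra.symmetric_decomposition scale bracket \<gg>0 \<gg>1"
    and "lie_algebra.symmetric_rank scale Basis bracket \<gg>1 = k"
    and "lie_algebra.maximal_abelian scale bracket \<gg>1 \<aa>"
    and "vector_space.dim scale \<aa> = k"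
    and "\<mm> = lie_algebra.orth_part scale Basis bracket \<gg>1 \<aa>"
    and "direct_sum \<aa> \<mm> \<gg>1"
    and "\<bb> = lie_algebra.cartan_b scale Basis bracket \<gg>0 \<aa>"
  shows "inj_on (lie_algebra.neg_ad bracket \<aa>) \<mm> \<and>
    lie_algebra.tableau_over scale bracket \<aa> \<bb> (lie_algebra.neg_ad bracket \<aa> ` \<mm>)"
proof -
  interpret lie_algebra scale Basis bracket by fact
  interpret cartan_subspace scale Basis bracket \<gg>0 \<gg>1 \<aa>
    by unfold_locales (use assms in simp_all)
  show ?thesis using neg_ad_inj tableau_over_cartan assms(7,9) by simp
qed

end
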